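(* There is an absolute constant $C>0$ such that the following holds. Let $\mathcal{V}=(V_1,\ldots,V_n)$ be a list of linear subspaces of $\mathbb{R}^\ell$, each of dimension at most $k$, such that $\mathcal{V}$ has an $(\alpha,\delta)$-system (with $\alpha$ a positive integer and $\delta>0$). Let $d=\dim(V_1+V_2+\cdots+V_n)$. Then $d\leq C\,\alpha^2k^4/\delta^2$.
   Context: Given $\mathcal{V}=(V_1,\ldots,V_n)$, a list of sets $\mathcal{S}=(S_1,\ldots,S_w)$ is an $(\alpha,\delta)$-system of $\mathcal{V}$ ($\alpha\in\mathbb{Z}^+$, $\delta>0$) if: (1) every $S_j$ is a subset of $[n]$ of size $3$ or $2$; (2) if $S_j=\{i_1,i_2,i_3\}$ has 3 elements then $V_{i_1}\subseteq V_{i_2}+V_{i_3}$, $V_{i_2}\subseteq V_{i_1}+V_{i_3}$ and $V_{i_3}\subseteq V_{i_1}+V_{i_2}$; if $S_j=\{i_1,i_2\}$ has 2 elements then $V_{i_1}=V_{i_2}$; (3) every $i\in[n]$ is contained in at least $\delta n$ of the sets of $\mathcal{S}$ (counted with multiplicity in the list); (4) every pair $\{i_1,i_2\}$ with $i_1\neq i_2\in[n]$ is contained together in at most $\alpha$ sets of $\mathcal{S}$. The paper states the conclusion as $d=O(\alpha^2k^4/\delta^2)$. *)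

theory Defs
  imports "HOL-Analysis.Analysis" "HOL-Analysis.Finite_Function_Topology" "HOL-Library.Set_Algebras"
begin

text \<open>
  \<open>\<real>\<^sup>l\<close> with \<open>l\<close> a term rather than a type: the vectors of the real vector space
  \<^typ>\<open>nat \<Rightarrow>\<^sub>0 real\<close> that are supported on the first \<open>l\<close> coordinates. A type-indexed
  \<open>\<real>\<^sup>l\<close> would force a constant claimed to be absolute to depend on \<open>l\<close>.
\<close>
definition real_space :: "nat \<Rightarrow> (nat \<Rightarrow>\<^sub>0 real) set" where
  "real_space l = {x. Poly_Mapping.keys x \<subseteq> {..<l}}"

text \<open>
  Indices run over \<open>{..<n}\<close>, and \<open>+\<close> on sets is the Minkowski sum, which for subspaces
  is their sum as subspaces.
\<close>
definition alpha_delta_system ::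
    "nat \<Rightarrow> real \<Rightarrow> 'a::real_vector set list \<Rightarrow> nat set list \<Rightarrow> bool" where
  "alpha_delta_system \<alpha> \<delta> V S \<longleftrightarrow>
     (\<forall>T \<in> set S. T \<subseteq> {..<length V} \<and> (card T = 3 \<or> card T = 2)) \<and>
     (\<forall>T \<in> set S. \<forall>i1 i2 i3. card T = 3 \<and> T = {i1, i2, i3} \<longrightarrow>
        V ! i1 \<subseteq> V ! i2 + V ! i3 \<and> V ! i2 \<subseteq> V ! i1 + V ! i3 \<and> V ! i3 \<subseteq> V ! i1 + V ! i2) \<and>
     (\<forall>T \<in> set S. \<forall>i1 i2. card T = 2 \<and> T = {i1, i2} \<longrightarrow> V ! i1 = V ! i2) \<and>
     (\<forall>i < length V. \<delta> * real (length V) \<le> real (length (filter (\<lambda>T. i \<in> T) S))) \<and>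
     (\<forall>i1 < length V. \<forall>i2 < length V. i1 \<noteq> i2 \<longrightarrow>
        length (filter (\<lambda>T. {i1, i2} \<subseteq> T) S) \<le> \<alpha>)"

end

theory Submission
  imports Defs
begin

text \<open>
  Put \<open>D = (\<Sum>i<n. dim (V i))\<close>. The proof gives the stronger bound \<open>\<delta> * n * d \<le> 2 * \<alpha> * D\<close>.

  Suppose first that some inner product on the span \<open>X\<close> of the \<open>V i\<close> makes the orthogonal
  projections satisfy \<open>(\<Sum>i<n. P i) \<le> \<gamma> * I\<close>. Then \<open>(\<Sum>i j. tr (P i * P j)) \<le> \<gamma> * D\<close>. On the other
  hand the three spaces of a triple, of total dimension \<open>r\<close>, lie in a space of dimension at most
  \<open>2/3 * r\<close>, so their pairwise traces \<open>tr (P i * P j)\<close> add up to at least \<open>r/4\<close>. Summation over the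
  system gives \<open>\<delta> * n \<le> 2 * \<alpha> * \<gamma>\<close>.

  Inner products are encoded by their dual forms \<open>Q\<close> on functionals, and the form of the inner product
  restricted to \<open>V i\<close> is denoted by \<open>Q i\<close>; it depends monotonically on \<open>Q\<close>. The iteration
  \<open>Q \<mapsto> ((\<Sum>i<n. Q i) + Q0) / \<gamma>\<close>, started at \<open>Q0 / \<gamma>\<close> for a fixed form \<open>Q0\<close>, is increasing. If
  \<open>\<gamma> < \<delta> * n / (2 * \<alpha>)\<close>, it cannot stay bounded, as it would then produce an inner product excluded by
  the first part. Hence the normalised forms accumulate at a nonzero, possibly degenerate form, which
  lives on a subspace \<open>R\<close> of \<open>X\<close> with \<open>\<gamma> * dim R \<le> (\<Sum>i<n. dim (V i \<inter> R))\<close>. The images of the \<open>V i\<close>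
  in the quotient by \<open>R\<close> again have the system, so that induction on the dimension gives the bound.
\<close>

section \<open>Finite-dimensional subspaces of a real vector space\<close>

text \<open>\<open>dim\<close> falls back to 0 on infinite-dimensional spaces, and the type of
  polynomial mappings is infinite-dimensional. Finiteness is therefore carried as a predicate,
  stated for arbitrary sets so that it passes to subsets.\<close>

definition fin_dim :: "'a::real_vector set \<Rightarrow> bool" where
  "fin_dim V \<longleftrightarrow> (\<exists>B. finite B \<and> V \<subseteq> span B)"

lemma fin_dim_subset: "V \<subseteq> W \<Longrightarrow> fin_dim W \<Longrightarrow> fin_dim V"
  unfolding fin_dim_def by blast

lemma fin_dim_basis:
  assumes "fin_dim V"
  obtains B where "finite B" "independent B" "B \<subseteq> V" "V \<subseteq> span B" "card B = dim V"
proof -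
  obtain B where B: "B \<subseteq> V" "independent B" "V \<subseteq> span B" "card B = dim V"
    by (rule basis_exists)
  obtain C where C: "finite C" "V \<subseteq> span C"
    using assms unfolding fin_dim_def by blast
  have "finite B"
    using independent_span_bound[OF C(1) B(2)] B(1) C(2) by blast
  with B that show ?thesis by blast
qed

lemma fin_dim_span_UN:
  assumes "finite I" "\<And>i. i \<in> I \<Longrightarrow> fin_dim (V i)"
  shows "fin_dim (span (\<Union>i\<in>I. V i))"
proof -
  have "\<forall>i\<in>I. \<exists>B. finite B \<and> V i \<subseteq> span B"
    using assms(2) unfolding fin_dim_def by blast
  then obtain B where B: "\<And>i. i \<in> I \<Longrightarrow> finite (B i) \<and> V i \<subseteq> span (B i)"
    by metis
  have "(\<Union>i\<in>I. V i) \<subseteq> span (\<Union>i\<in>I. B i)"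
  proof
    fix x assume "x \<in> (\<Union>i\<in>I. V i)"
    then obtain i where i: "i \<in> I" "x \<in> V i" by blast
    then have "x \<in> span (B i)" using B by blast
    moreover have "span (B i) \<subseteq> span (\<Union>i\<in>I. B i)" using i by (intro span_mono) blast
    ultimately show "x \<in> span (\<Union>i\<in>I. B i)" by blast
  qed
  then have "span (\<Union>i\<in>I. V i) \<subseteq> span (\<Union>i\<in>I. B i)"
    by (simp add: span_minimal)
  moreover have "finite (\<Union>i\<in>I. B i)"
    using assms(1) B by blast
  ultimately show ?thesis
    unfolding fin_dim_def by blast
qed

lemma fin_dim_image:
  assumes "linear f" "fin_dim V"
  shows "fin_dim (f ` V)"
proof -
  obtain B where B: "finite B" "V \<subseteq> span B"
    using assms(2) unfolding fin_dim_def by blast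
  have "f ` V \<subseteq> span (f ` B)"
    using B(2) by (simp add: image_mono linear_span_image[OF assms(1)])
  then show ?thesis
    unfolding fin_dim_def using B(1) by blast
qed

lemma dim_mono_fin_dim:
  assumes "V \<subseteq> W" "fin_dim W"
  shows "dim V \<le> dim W"
proof -
  obtain B where "finite B" "W \<subseteq> span B" "card B = dim W"
    using fin_dim_basis[OF assms(2)] by metis
  then show ?thesis
    using dim_le_card[of V B] assms(1) by auto
qed

lemma dim_pos_fin_dim:
  assumes "fin_dim V" "x \<in> V" "x \<noteq> 0"
  shows "dim V > 0"
proof -
  have "dim {x} = 1"
    using dim_eq_card_independent[of "{x}"] assms(3) by simp
  then show ?thesis
    using dim_mono_fin_dim[of "{x}" V] assms by simp
qed

lemma dim_le_dim_add_dim: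
  assumes "U \<subseteq> V + W" "fin_dim V" "fin_dim W"
  shows "dim U \<le> dim V + dim W"
proof -
  obtain B where B: "finite B" "V \<subseteq> span B" "card B = dim V"
    using fin_dim_basis[OF assms(2)] by metis
  obtain C where C: "finite C" "W \<subseteq> span C" "card C = dim W"
    using fin_dim_basis[OF assms(3)] by metis
  have "U \<subseteq> span (B \<union> C)"
  proof
    fix u assume "u \<in> U"
    then obtain v w where u: "u = v + w" "v \<in> V" "w \<in> W"
      using assms(1) by (metis set_plus_elim subsetD)
    have "span B \<subseteq> span (B \<union> C)" "span C \<subseteq> span (B \<union> C)"
      by (intro span_mono; blast)+
    then show "u \<in> span (B \<union> C)"
      using u B(2) C(2) by (auto intro!: span_add)
  qed
  then have "dim U \<le> card (B \<union> C)"
    using B(1) C(1) by (intro dim_le_card) auto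
  also have "\<dots> \<le> card B + card C" by (rule card_Un_le)
  finally show ?thesis using B C by simp
qed

text \<open>A vector outside \<open>V\<close> is independent of a basis of \<open>V\<close>, so its
  value can be prescribed freely. The class \<open>real_vector\<close> has no topology; limit
  vectors are later placed in a subspace by testing them against functionals that vanish on
  it.\<close>

lemma separating_functional:
  fixes V :: "'a::real_vector set"
  assumes "subspace V" "x \<notin> V"
  obtains f :: "'a \<Rightarrow> real" where "linear f" "\<And>v. v \<in> V \<Longrightarrow> f v = 0" "f x = 1"
proof -
  obtain B where B: "B \<subseteq> V" "independent B" "V \<subseteq> span B" by (rule maximal_independent_subset)
  have "span B = V"
    using B assms(1) by (simp add: span_subspace)
  then have "x \<notin> span B" using assms(2) by simp
  then have "independent (insert x B)"
    using B(2) by (simp add: independent_insertI)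
  then obtain f :: "'a \<Rightarrow> real" where f: "linear f" "\<forall>y\<in>insert x B. f y = (if y = x then 1 else 0)"
    using linear_independent_extend[of "insert x B" "\<lambda>y. if y = x then 1 else 0"] by metis
  have xB: "x \<notin> B" using \<open>x \<notin> span B\<close> span_base by blast
  have "f v = 0" if "v \<in> V" for v
  proof (rule linear_eq_0_on_span[OF f(1)])
    show "f y = 0" if "y \<in> B" for y using f(2) that xB by auto
    show "v \<in> span B" using that B by blast
  qed
  then show ?thesis using that f by auto
qed

section \<open>Quotients inside the same type, and the two halves of rank-nullity\<close>

text \<open>The quotient by \<open>R\<close> is realised as the image of an endomorphism, so that an
  induction over quotients never changes the type. The map kills a basis of \<open>R\<close> and
  fixes the rest of a basis of the whole space; hence \<open>x - p x\<close> always lies in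
  \<open>R\<close>.\<close>

lemma linear_with_kernel:
  fixes R :: "'a::real_vector set"
  assumes "subspace R"
  obtains p :: "'a \<Rightarrow> 'a" where "linear p" "\<And>x. p x = 0 \<longleftrightarrow> x \<in> R"
proof -
  obtain B where B: "B \<subseteq> R" "independent B" "R \<subseteq> span B" by (rule maximal_independent_subset)
  have spB: "span B = R" using B assms by (simp add: span_subspace)
  obtain C where C: "B \<subseteq> C" "independent C" "UNIV \<subseteq> span C"
    using maximal_independent_subset_extend[of B UNIV] B(2) by auto
  obtain p :: "'a \<Rightarrow> 'a" where p: "linear p" "\<forall>y\<in>C. p y = (if y \<in> B then 0 else y)"
    using linear_independent_extend[OF C(2), of "\<lambda>y. if y \<in> B then 0 else y"] by metis
  have pR: "p x = 0" if "x \<in> R" for x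
  proof (rule linear_eq_0_on_span[OF p(1)])
    show "p y = 0" if "y \<in> B" for y using p(2) that C by auto
    show "x \<in> span B" using that spB by blast
  qed
  interpret p: linear p by (rule p(1))
  have "x - p x \<in> span B" for x
  proof -
    have "x \<in> span C" using C by auto
    then show ?thesis
    proof (induction rule: span_induct_alt)
      case base then show ?case by (simp add: p.zero span_zero)
    next
      case (step c y z)
      have "y - p y \<in> span B" using p(2) step(1) by (auto simp: span_base span_zero)
      then have "c *\<^sub>R (y - p y) + (z - p z) \<in> span B"
        using step(2) by (intro span_add span_scale)
      then show ?case
        by (simp add: p.add p.scale algebra_simps)
    qed
  qed
  then have "x \<in> R" if "p x = 0" for x using that spB by (metis diff_zero)
  with pR that p(1) show ?thesis by blast
qed

text \<open>Extend a basis \<open>B\<close> of \<open>V \<inter> R\<close> to a basis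
  \<open>C\<close> of \<open>V\<close>. Since \<open>p\<close> kills \<open>B\<close>, the images of
  \<open>C - B\<close> already span the image.\<close>

lemma dim_image_add_dim_kernel_le:
  fixes p :: "'a::real_vector \<Rightarrow> 'b::real_vector"
  assumes p: "linear p" "\<And>x. x \<in> R \<Longrightarrow> p x = 0" and V: "fin_dim V"
  shows "dim (p ` V) + dim (V \<inter> R) \<le> dim V"
proof -
  obtain B where B: "finite B" "independent B" "B \<subseteq> V \<inter> R" "card B = dim (V \<inter> R)"
    using fin_dim_basis[OF fin_dim_subset[OF Int_lower1 V]] by metis
  obtain C where C: "B \<subseteq> C" "C \<subseteq> V" "independent C" "V \<subseteq> span C"
    using maximal_independent_subset_extend[of B V] B by auto
  have dC: "card C = dim V" using C basis_card_eq_dim by blast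
  obtain W where W: "finite W" "V \<subseteq> span W" using V unfolding fin_dim_def by blast
  have fC: "finite C" using independent_span_bound[OF W(1) C(3)] C(2) W(2) by blast
  have "p ` V \<subseteq> span (p ` C)"
    using C(4) by (simp add: image_mono linear_span_image[OF p(1)])
  also have "\<dots> \<subseteq> span (p ` (C - B))"
  proof (rule span_minimal)
    show "p ` C \<subseteq> span (p ` (C - B))"
    proof
      fix y assume "y \<in> p ` C"
      then obtain c where c: "c \<in> C" "y = p c" by blast
      show "y \<in> span (p ` (C - B))"
      proof (cases "c \<in> B")
        case True then show ?thesis using c B p(2) by (auto simp: span_zero)
      next
        case False then show ?thesis using c by (auto intro: span_base)
      qed
    qed
  qed auto
  finally have "dim (p ` V) \<le> card (p ` (C - B))"
    using fC by (intro dim_le_card) auto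
  also have "\<dots> \<le> card (C - B)" using fC by (simp add: card_image_le)
  also have "\<dots> = card C - card B" using B C by (simp add: card_Diff_subset)
  finally show ?thesis using dC B(4) card_mono[OF fC C(1)] by linarith
qed

text \<open>Lifts of a basis of the image together with a basis of \<open>R\<close> span
  \<open>V\<close>: a vector and the combination of lifts with the same image differ by a kernel
  element.\<close>

lemma dim_le_dim_image_add_dim_kernel:
  fixes p :: "'a::real_vector \<Rightarrow> 'b::real_vector"
  assumes p: "linear p" "\<And>x. p x = 0 \<Longrightarrow> x \<in> R" and V: "fin_dim V" and R: "fin_dim R"
  shows "dim V \<le> dim (p ` V) + dim R"
proof -
  obtain D where D: "finite D" "D \<subseteq> p ` V" "p ` V \<subseteq> span D" "card D = dim (p ` V)"
    using fin_dim_basis[OF fin_dim_image[OF p(1) V]] by metis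
  obtain C where C: "C \<subseteq> V" "finite C" "D = p ` C" "card C = card D"
    using subset_image_inj[of D p V] D(1,2) by (metis card_image finite_imageD)
  obtain B where B: "finite B" "R \<subseteq> span B" "card B = dim R"
    using fin_dim_basis[OF R] by metis
  have "V \<subseteq> span (C \<union> B)"
  proof
    fix x assume "x \<in> V"
    then have "p x \<in> p ` span C" using D(3) C(3) linear_span_image[OF p(1)] by blast
    then obtain y where y: "y \<in> span C" "p x = p y" by blast
    then have "x - y \<in> span B" using p(2)[of "x - y"] B(2) linear_diff[OF p(1)] by auto
    then have "y + (x - y) \<in> span (C \<union> B)"
      using y(1) span_mono[of C "C \<union> B"] span_mono[of B "C \<union> B"]
      by (intro span_add) auto
    then show "x \<in> span (C \<union> B)" by simp
  qed
  then have "dim V \<le> card (C \<union> B)" using B C by (intro dim_le_card) auto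
  also have "\<dots> \<le> card C + card B" by (rule card_Un_le)
  finally show ?thesis using B C D by simp
qed

section \<open>Bases indexed by natural numbers and their dual bases\<close>

text \<open>A spanning family of \<open>dim V\<close> vectors is automatically linearly independent.\<close>

definition basis_of :: "'a::real_vector set \<Rightarrow> (nat \<Rightarrow> 'a) \<Rightarrow> bool" where
  "basis_of V b \<longleftrightarrow> span (b ` {..<dim V}) = V"

lemma basis_of_exists:
  assumes "subspace V" "fin_dim V"
  obtains b where "basis_of V b"
proof -
  obtain B where B: "finite B" "B \<subseteq> V" "V \<subseteq> span B" "card B = dim V"
    using fin_dim_basis[OF assms(2)] by metis
  obtain b where "bij_betw b {..<card B} B"
    using ex_bij_betw_nat_finite[OF B(1)] by (auto simp: atLeast0LessThan)
  then have "b ` {..<dim V} = B" using B by (simp add: bij_betw_def)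
  then have "basis_of V b" unfolding basis_of_def using B assms(1) by (simp add: span_subspace)
  then show ?thesis using that by blast
qed

lemma basis_of_in: "basis_of V b \<Longrightarrow> j < dim V \<Longrightarrow> b j \<in> V"
  unfolding basis_of_def by (metis image_eqI lessThan_iff span_base)

lemma basis_of_fin_dim: "basis_of V b \<Longrightarrow> fin_dim V"
  unfolding basis_of_def fin_dim_def by blast

lemma basis_of_subspace: "basis_of V b \<Longrightarrow> subspace V"
  unfolding basis_of_def by (metis subspace_span)

lemma basis_of_inj_independent:
  assumes "basis_of V b"
  shows "inj_on b {..<dim V}" "independent (b ` {..<dim V})"
proof -
  let ?B = "b ` {..<dim V}"
  have sp: "span ?B = V" using assms by (simp add: basis_of_def)
  obtain C where C: "C \<subseteq> ?B" "independent C" "?B \<subseteq> span C" by (rule maximal_independent_subset)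
  have "V \<subseteq> span C" using C(3) sp by (metis span_minimal subspace_span)
  moreover have "span C \<subseteq> V" using C(1) sp span_mono by blast
  ultimately have "card C = dim V" using dim_eq_card[of C V] C(2)
    by (metis sp span_span subset_antisym)
  moreover have "card C \<le> card ?B" using C(1) by (simp add: card_mono)
  moreover have "card ?B \<le> dim V" using card_image_le[of "{..<dim V}" b] by simp
  ultimately have *: "card ?B = dim V" "card C = card ?B" by auto
  then show "inj_on b {..<dim V}" by (intro eq_card_imp_inj_on) auto
  have "C = ?B" using * C(1) by (simp add: card_subset_eq)
  then show "independent ?B" using C(2) by simp
qed

lemma dual_basis_exists:
  fixes V :: "'a::real_vector set"
  assumes "basis_of V b"
  obtains d :: "nat \<Rightarrow> 'a \<Rightarrow> real" where "\<And>j. linear (d j)"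
    "\<And>i j. i < dim V \<Longrightarrow> d j (b i) = (if i = j then 1 else 0)"
    "\<And>x. x \<in> V \<Longrightarrow> x = (\<Sum>j<dim V. d j x *\<^sub>R b j)"
proof -
  note ib = basis_of_inj_independent[OF assms]
  have "\<exists>f::'a \<Rightarrow> real. linear f \<and> (\<forall>i<dim V. f (b i) = (if i = j then 1 else 0))" for j
  proof -
    obtain f :: "'a \<Rightarrow> real" where f: "linear f"
      "\<forall>y\<in>b ` {..<dim V}. f y = (if the_inv_into {..<dim V} b y = j then 1 else 0)"
      using linear_independent_extend[OF ib(2), of "\<lambda>y. if the_inv_into {..<dim V} b y = j then 1 else 0"]
      by metis
    then show ?thesis using ib(1) by (auto simp: the_inv_into_f_f)
  qed
  then obtain d :: "nat \<Rightarrow> 'a \<Rightarrow> real" where d: "\<And>j. linear (d j)"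
    "\<And>i j. i < dim V \<Longrightarrow> d j (b i) = (if i = j then 1 else 0)"
    by metis
  have lin: "linear (\<lambda>x. \<Sum>j<dim V. d j x *\<^sub>R b j)"
    by (intro linear_compose_sum ballI linear_compose[OF d(1), of "\<lambda>r. r *\<^sub>R _", unfolded o_def])
       (simp add: linear_scaleR_left)
  have "x = (\<Sum>j<dim V. d j x *\<^sub>R b j)" if "x \<in> V" for x
  proof (rule linear_eq_on_span[OF linear_id[unfolded id_def] lin])
    show "x \<in> span (b ` {..<dim V})" using that assms by (simp add: basis_of_def)
    fix y assume "y \<in> b ` {..<dim V}"
    then obtain i where i: "i < dim V" "y = b i" by auto
    have "(\<Sum>j<dim V. d j (b i) *\<^sub>R b j) = (\<Sum>j<dim V. if i = j then b j else 0)"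
      using i d(2) by (intro sum.cong) auto
    also have "\<dots> = b i" using i by simp
    finally show "y = (\<Sum>j<dim V. d j y *\<^sub>R b j)" using i by simp
  qed
  with d that show ?thesis by blast
qed

section \<open>Positive semidefinite forms on the dual space\<close>

text \<open>A form on functionals is represented by a family of vectors instead of a matrix. For an
  orthonormal basis the value is the squared dual norm of \<open>f\<close>; a general finite family
  gives a possibly degenerate form living on its span.\<close>

definition frame_form :: "'i set \<Rightarrow> ('i \<Rightarrow> 'a) \<Rightarrow> ('a \<Rightarrow> real) \<Rightarrow> real" where
  "frame_form I b f = (\<Sum>i\<in>I. (f (b i))\<^sup>2)"

lemma frame_form_nonneg: "frame_form I b f \<ge> 0"
  unfolding frame_form_def by (simp add: sum_nonneg)

lemma linear_apply_sum:
  fixes f :: "'a::real_vector \<Rightarrow> real"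
  assumes "linear f"
  shows "f (\<Sum>j\<in>J. r j *\<^sub>R x j) = (\<Sum>j\<in>J. r j * f (x j))"
  using assms by (simp add: linear_sum linear_scale)

text \<open>
  Adding \<open>f x ^ 2\<close> to the form of a basis \<open>b\<close>, where \<open>x = (\<Sum>j. \<mu> j *\<^sub>R b j)\<close>, amounts to replacing
  \<open>b j\<close> by \<open>b j + \<kappa> * \<mu> j *\<^sub>R x\<close>, where \<open>\<kappa>\<close> solves \<open>2 * \<kappa> + \<kappa>^2 * (\<Sum>j. \<mu> j ^ 2) = 1\<close>.
\<close>

lemma basis_of_rank_one_update:
  fixes V :: "'a::real_vector set"
  assumes b: "basis_of V b" and x: "x \<in> V"
  obtains b' where "basis_of V b'"
    "\<And>f. linear f \<Longrightarrow> frame_form {..<dim V} b' f = frame_form {..<dim V} b f + (f x)\<^sup>2"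
proof -
  obtain d :: "nat \<Rightarrow> 'a \<Rightarrow> real" where d: "x = (\<Sum>j<dim V. d j x *\<^sub>R b j)"
    using dual_basis_exists[OF b] x by metis
  define \<mu> where "\<mu> j = d j x" for j
  define s where "s = (\<Sum>j<dim V. (\<mu> j)\<^sup>2)"
  \<comment> \<open>\<open>1 / r\<close> is the positive root of
    \<open>s * \<kappa>^2 + 2 * \<kappa> = 1\<close>, written so that \<open>s = 0\<close> needs no
    separate case.\<close>
  define r where "r = 1 + sqrt (1 + s)"
  define \<kappa> where "\<kappa> = 1 / r"
  have s0: "s \<ge> 0" by (simp add: s_def sum_nonneg)
  have r0: "r > 0" using s0 unfolding r_def by (simp add: add_pos_nonneg)
  have rr: "2 * r + s = r * r"
    using s0 unfolding r_def by (simp add: algebra_simps)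
  have "2 * \<kappa> + \<kappa>\<^sup>2 * s = (2 * r + s) / (r * r)"
    using r0 unfolding \<kappa>_def by (simp add: add_divide_distrib power2_eq_square)
  then have \<kappa>: "2 * \<kappa> + \<kappa>\<^sup>2 * s = 1"
    unfolding rr using r0 by simp
  have \<kappa>0: "\<kappa> > 0" using r0 by (simp add: \<kappa>_def)
  define b' where "b' j = b j + (\<kappa> * \<mu> j) *\<^sub>R x" for j
  have sV: "subspace V" using b by (rule basis_of_subspace)
  have "span (b' ` {..<dim V}) \<subseteq> V"
  proof (rule span_minimal[OF _ sV])
    show "b' ` {..<dim V} \<subseteq> V"
      using basis_of_in[OF b] x sV by (auto simp: b'_def intro!: subspace_add subspace_scale)
  qed
  moreover have "V \<subseteq> span (b' ` {..<dim V})"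
  proof -
    let ?S = "span (b' ` {..<dim V})"
    have xS0: "(\<Sum>j<dim V. \<mu> j *\<^sub>R b' j) \<in> ?S"
      by (intro span_sum span_scale span_base) auto
    \<comment> \<open>The combination of the new vectors with coefficients \<open>\<mu> j\<close> is
      a positive multiple of \<open>x\<close>. So \<open>x\<close>, and then every
      \<open>b j\<close>, is recovered from the new family.\<close>
    have "(\<Sum>j<dim V. \<mu> j *\<^sub>R b' j) = (\<Sum>j<dim V. \<mu> j *\<^sub>R b j) + (\<Sum>j<dim V. (\<kappa> * (\<mu> j)\<^sup>2) *\<^sub>R x)"
      by (simp add: b'_def scaleR_add_right sum.distrib power2_eq_square mult_ac)
    also have "\<dots> = (1 + \<kappa> * s) *\<^sub>R x"
    proof -
      have "(\<Sum>j<dim V. (\<kappa> * (\<mu> j)\<^sup>2) *\<^sub>R x) = (\<kappa> * s) *\<^sub>R x"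
        unfolding s_def sum_distrib_left by (rule scaleR_sum_left[symmetric])
      moreover have "(\<Sum>j<dim V. \<mu> j *\<^sub>R b j) = x" using d by (simp add: \<mu>_def)
      ultimately show ?thesis by (simp add: scaleR_add_left)
    qed
    finally have "(1 + \<kappa> * s) *\<^sub>R x \<in> ?S"
      by (metis (no_types, lifting) xS0)
    moreover have "1 + \<kappa> * s \<noteq> 0" using \<kappa>0 s0 by (smt (verit) mult_nonneg_nonneg)
    ultimately have xS: "x \<in> ?S"
      using span_scale[of "(1 + \<kappa> * s) *\<^sub>R x" _ "inverse (1 + \<kappa> * s)"] by simp
    have "b j \<in> ?S" if "j < dim V" for j
    proof -
      have "b' j - (\<kappa> * \<mu> j) *\<^sub>R x \<in> ?S"
        using that by (intro span_diff[OF span_base span_scale[OF xS]]) auto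
      then show ?thesis by (simp add: b'_def)
    qed
    then have "span (b ` {..<dim V}) \<subseteq> ?S" by (intro span_minimal) auto
    then show ?thesis using b by (simp add: basis_of_def)
  qed
  ultimately have "basis_of V b'" unfolding basis_of_def by blast
  moreover have "frame_form {..<dim V} b' f = frame_form {..<dim V} b f + (f x)\<^sup>2" if f: "linear f" for f
  proof -
    have fx: "(\<Sum>j<dim V. \<mu> j * f (b j)) = f x"
      using linear_apply_sum[OF f, of \<mu> b "{..<dim V}"] d by (simp add: \<mu>_def)
    have "frame_form {..<dim V} b' f = (\<Sum>j<dim V. (f (b j) + \<kappa> * \<mu> j * f x)\<^sup>2)"
      using f by (simp add: frame_form_def b'_def linear_add linear_scale)
    also have "\<dots> = (\<Sum>j<dim V. (f (b j))\<^sup>2 + 2 * \<kappa> * f x * (\<mu> j * f (b j)) + \<kappa>\<^sup>2 * (f x)\<^sup>2 * (\<mu> j)\<^sup>2)"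
      by (intro sum.cong) (auto simp: power2_eq_square algebra_simps)
    also have "\<dots> = frame_form {..<dim V} b f + 2 * \<kappa> * f x * f x + \<kappa>\<^sup>2 * (f x)\<^sup>2 * s"
      by (simp add: sum.distrib sum_distrib_left[symmetric] fx frame_form_def s_def)
    also have "\<dots> = frame_form {..<dim V} b f + (2 * \<kappa> + \<kappa>\<^sup>2 * s) * (f x)\<^sup>2"
      by (simp add: power2_eq_square algebra_simps)
    finally show ?thesis using \<kappa> by simp
  qed
  ultimately show ?thesis using that by blast
qed

lemma span_insert_span: "span (insert x (span B)) = span (insert x B)"
proof (intro subset_antisym span_minimal)
  show "insert x (span B) \<subseteq> span (insert x B)"
    using span_mono[of B "insert x B"] by (auto intro: span_base)
  show "insert x B \<subseteq> span (insert x (span B))"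
    by (auto intro!: span_base)
qed auto

lemma basis_of_adjoin:
  assumes b: "basis_of V b" and x: "x \<notin> V"
  shows "dim (span (insert x V)) = Suc (dim V)"
    and "basis_of (span (insert x V)) (b(dim V := x))"
proof -
  let ?B = "b ` {..<dim V}"
  have sp: "span ?B = V" using b by (simp add: basis_of_def)
  note ib = basis_of_inj_independent[OF b]
  have "independent (insert x ?B)" using ib(2) x sp by (intro independent_insertI) auto
  moreover have "card (insert x ?B) = Suc (dim V)"
  proof -
    have "x \<notin> ?B" using x sp span_base[of x ?B] by auto
    then show ?thesis using ib(1) by (simp add: card_image)
  qed
  moreover have eq: "span (insert x ?B) = span (insert x V)"
    using span_insert_span[of x ?B] sp by simp
  ultimately show d: "dim (span (insert x V)) = Suc (dim V)"
    by (metis dim_eq_card dim_span)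
  have "(b(dim V := x)) ` {..<Suc (dim V)} = insert x ?B"
    by (auto simp: lessThan_Suc)
  then show "basis_of (span (insert x V)) (b(dim V := x))"
    unfolding basis_of_def d using eq by simp
qed

text \<open>The vectors of the family are inserted one at a time: one outside the current span is
  appended to the basis, one inside is absorbed by the rank-one update. This turns the form of any
  finite family into the dual form of a genuine inner product on its span.\<close>

lemma basis_with_frame_form:
  fixes w :: "'i \<Rightarrow> 'a::real_vector"
  assumes "finite I"
  obtains b where "basis_of (span (w ` I)) b"
    "\<And>f. linear f \<Longrightarrow> frame_form {..<dim (span (w ` I))} b f = frame_form I w f"
proof -
  have "\<exists>b. basis_of (span (w ` I)) b \<and>
          (\<forall>f. linear f \<longrightarrow> frame_form {..<dim (span (w ` I))} b f = frame_form I w f)"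
    using assms
  proof (induction I rule: finite_induct)
    case empty
    have "dim {0::'a} = 0" by (metis card.empty dim_le_card empty_subsetI finite.emptyI le_zero_eq span_empty subset_refl)
    then show ?case by (simp add: basis_of_def frame_form_def)
  next
    case (insert i I)
    define V where "V = span (w ` I)"
    obtain b where b: "basis_of V b" "\<And>f. linear f \<Longrightarrow> frame_form {..<dim V} b f = frame_form I w f"
      using insert.IH unfolding V_def by blast
    have sp: "span (w ` insert i I) = span (insert (w i) V)"
      unfolding V_def by (simp add: span_insert_span)
    show ?case
    proof (cases "w i \<in> V")
      case True
      then have sp': "span (w ` insert i I) = V" using sp unfolding V_def
        by (metis span_base span_redundant span_span)
      obtain b' where "basis_of V b'"
        "\<And>f. linear f \<Longrightarrow> frame_form {..<dim V} b' f = frame_form {..<dim V} b f + (f (w i))\<^sup>2"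
        using basis_of_rank_one_update[OF b(1) True] by blast
      then show ?thesis unfolding sp' using b(2) insert.hyps
        by (intro exI[of _ b']) (simp add: frame_form_def)
    next
      case False
      note a = basis_of_adjoin[OF b(1) False]
      have "frame_form {..<Suc (dim V)} (b(dim V := w i)) f = frame_form (insert i I) w f"
        if "linear f" for f
        using b(2)[OF that] insert.hyps by (simp add: frame_form_def)
      then show ?thesis unfolding sp using a by (metis (no_types, lifting))
    qed
  qed
  then show ?thesis using that by blast
qed

section \<open>Orthonormal bases\<close>

text \<open>The form is total and semidefinite on the whole type, with definiteness asked only on
  \<open>V\<close>. In this way each \<open>g x\<close> is a linear functional on the type and can
  be an argument of \<open>frame_form\<close>.\<close>

definition inner_on :: "'a::real_vector set \<Rightarrow> ('a \<Rightarrow> 'a \<Rightarrow> real) \<Rightarrow> bool" where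
  "inner_on V g \<longleftrightarrow> (\<forall>x. linear (g x)) \<and> (\<forall>x y. g x y = g y x) \<and> (\<forall>x. 0 \<le> g x x) \<and>
     (\<forall>x\<in>V. g x x = 0 \<longrightarrow> x = 0)"

definition orthonormal_basis :: "('a::real_vector \<Rightarrow> 'a \<Rightarrow> real) \<Rightarrow> 'a set \<Rightarrow> (nat \<Rightarrow> 'a) \<Rightarrow> bool" where
  "orthonormal_basis g V c \<longleftrightarrow> basis_of V c \<and>
     (\<forall>i<dim V. \<forall>j<dim V. g (c i) (c j) = (if i = j then 1 else 0))"

lemma orthonormal_basis_in: "orthonormal_basis g V c \<Longrightarrow> j < dim V \<Longrightarrow> c j \<in> V"
  unfolding orthonormal_basis_def using basis_of_in[of V c j] by simp

lemma inner_on_linear: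
  assumes "inner_on X g"
  shows "linear (g x)" "g (\<Sum>j\<in>J. r j *\<^sub>R y j) z = (\<Sum>j\<in>J. r j * g (y j) z)"
    "g (x - y') z = g x z - g y' z" "g (t *\<^sub>R x) z = t * g x z"
proof -
  have l: "linear (g x)" "g x y = g y x" for x y using assms unfolding inner_on_def by auto
  show "linear (g x)" by (rule l)
  show "g (\<Sum>j\<in>J. r j *\<^sub>R y j) z = (\<Sum>j\<in>J. r j * g (y j) z)"
    unfolding l(2)[of _ z] by (rule linear_apply_sum[OF l(1)])
  show "g (x - y') z = g x z - g y' z"
    unfolding l(2)[of _ z] by (rule linear_diff[OF l(1)])
  show "g (t *\<^sub>R x) z = t * g x z"
    unfolding l(2)[of _ z] by (simp add: linear_scale[OF l(1)])
qed

lemma orthonormal_basis_expand: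
  assumes g: "inner_on X g" and c: "orthonormal_basis g V c" and x: "x \<in> V"
  shows "x = (\<Sum>j<dim V. g (c j) x *\<^sub>R c j)"
proof -
  obtain d :: "nat \<Rightarrow> 'a \<Rightarrow> real" where d: "x = (\<Sum>j<dim V. d j x *\<^sub>R c j)"
    using dual_basis_exists[of V c] c x unfolding orthonormal_basis_def by metis
  have "g (c i) x = d i x" if "i < dim V" for i
  proof -
    have "g (c i) x = (\<Sum>j<dim V. d j x * g (c i) (c j))"
      using linear_apply_sum[OF inner_on_linear(1)[OF g], of "c i" "\<lambda>j. d j x" c "{..<dim V}"] d by simp
    also have "\<dots> = (\<Sum>j<dim V. if i = j then d j x else 0)"
      using c that unfolding orthonormal_basis_def by (intro sum.cong) auto
    finally show ?thesis using that by simp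
  qed
  then show ?thesis using d by (metis (no_types, lifting) lessThan_iff sum.cong)
qed

lemma orthonormal_basis_parseval:
  assumes g: "inner_on X g" and c: "orthonormal_basis g V c" and x: "x \<in> V"
  shows "g x y = (\<Sum>j<dim V. g (c j) x * g (c j) y)"
  using inner_on_linear(2)[OF g, of "\<lambda>j. g (c j) x" c "{..<dim V}" y]
    orthonormal_basis_expand[OF assms] by simp

text \<open>Gram-Schmidt, one element of \<open>B\<close> at a time. The inclusion in
  \<open>X\<close> guarantees that the nonzero residual \<open>u\<close> has positive norm and can
  be normalised.\<close>

lemma orthonormal_basis_exists_span:
  assumes g: "inner_on X g" and "finite B" "span B \<subseteq> X"
  shows "\<exists>c. orthonormal_basis g (span B) c"
  using assms(2,3)
proof (induction B rule: finite_induct)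
  case empty
  have "dim {0::'a} = 0" by (metis card.empty dim_le_card empty_subsetI finite.emptyI le_zero_eq span_empty subset_refl)
  then show ?case by (simp add: orthonormal_basis_def basis_of_def)
next
  case (insert x B)
  define V where "V = span B"
  have VX: "V \<subseteq> X" using insert.prems span_mono[of B "insert x B"] unfolding V_def by blast
  then obtain c where c: "orthonormal_basis g V c" using insert.IH unfolding V_def by blast
  have sV: "subspace V" by (simp add: V_def)
  show ?case
  proof (cases "x \<in> V")
    case True
    then show ?thesis using c unfolding V_def by (metis span_redundant)
  next
    case False
    define y where "y = (\<Sum>j<dim V. g (c j) x *\<^sub>R c j)"
    have yV: "y \<in> V" unfolding y_def using sV orthonormal_basis_in[OF c]
      by (intro subspace_sum subspace_scale) auto
    define u where "u = x - y"
    have uV: "u \<notin> V" using False yV sV unfolding u_def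
      by (metis diff_add_cancel subspace_add)
    have spu: "span (insert u V) = span (insert x V)"
    proof -
      have "u \<in> span (insert x V)" unfolding u_def using yV
        by (intro span_diff span_base) auto
      moreover have "u + y \<in> span (insert u V)" using yV by (intro span_add span_base) auto
      then have "x \<in> span (insert u V)" by (simp add: u_def)
      ultimately show ?thesis
        by (intro subset_antisym span_minimal) (auto intro: span_base)
    qed
    have spx: "span (insert x V) = span (insert x B)" unfolding V_def
      by (rule span_insert_span)
    have "u \<in> span (insert u V)" by (rule span_base) simp
    then have "u \<in> X" using spu spx insert.prems by auto
    moreover have "u \<noteq> 0" using uV subspace_0[OF sV] by auto
    ultimately have gu: "g u u > 0" using g unfolding inner_on_def by (metis less_eq_real_def)
    define e where "e = (1 / sqrt (g u u)) *\<^sub>R u"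
    have eV: "e \<notin> V"
    proof
      assume "e \<in> V"
      then have "sqrt (g u u) *\<^sub>R e \<in> V" by (rule subspace_scale[OF sV])
      then show False using gu uV by (simp add: e_def)
    qed
    have spe: "span (insert e V) = span (insert u V)"
    proof -
      have "sqrt (g u u) *\<^sub>R e \<in> span (insert e V)" by (intro span_scale span_base) auto
      then have "u \<in> span (insert e V)" using gu by (simp add: e_def)
      moreover have "e \<in> span (insert u V)" unfolding e_def by (intro span_scale span_base) auto
      ultimately show ?thesis
        by (intro subset_antisym span_minimal) (auto intro: span_base)
    qed
    have ee: "g e e = 1"
    proof -
      have "g e e = (1 / sqrt (g u u)) * ((1 / sqrt (g u u)) * g u u)"
        unfolding e_def using inner_on_linear(4)[OF g] linear_scale[OF inner_on_linear(1)[OF g]] by simp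
      also have "\<dots> = g u u / (sqrt (g u u) * sqrt (g u u))" by simp
      also have "\<dots> = 1" using gu by simp
      finally show ?thesis .
    qed
    have ce: "g (c i) e = 0" if "i < dim V" for i
    proof -
      have "g (c i) y = (\<Sum>j<dim V. g (c j) x * g (c i) (c j))"
        unfolding y_def by (rule linear_apply_sum[OF inner_on_linear(1)[OF g]])
      also have "\<dots> = (\<Sum>j<dim V. if i = j then g (c j) x else 0)"
        using c that unfolding orthonormal_basis_def by (intro sum.cong) auto
      finally have "g (c i) y = g (c i) x" using that by simp
      then have "g (c i) u = 0" unfolding u_def using linear_diff[OF inner_on_linear(1)[OF g]] by simp
      then show ?thesis unfolding e_def using linear_scale[OF inner_on_linear(1)[OF g]] by simp
    qed
    have ec: "g e (c i) = 0" if "i < dim V" for i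
      using ce[OF that] g unfolding inner_on_def by metis
    have bc: "basis_of V c" using c unfolding orthonormal_basis_def by blast
    note a = basis_of_adjoin[OF bc eV]
    have "orthonormal_basis g (span (insert e V)) (c(dim V := e))"
      unfolding orthonormal_basis_def using a c ee ec ce
      by (auto simp: less_Suc_eq orthonormal_basis_def simp del: dim_span)
    then show ?thesis using spe spu spx by metis
  qed
qed

lemma orthonormal_basis_exists:
  assumes "inner_on X g" "subspace V" "fin_dim V" "V \<subseteq> X"
  obtains c where "orthonormal_basis g V c"
proof -
  obtain B where "finite B" "B \<subseteq> V" "V \<subseteq> span B" using fin_dim_basis[OF assms(3)] by metis
  then show ?thesis
    using orthonormal_basis_exists_span[OF assms(1), of B] span_subspace[of B V] assms that by metis
qed

text \<open>Declare \<open>b\<close> orthonormal: the inner product is the sum of the squares of the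
  dual coordinates, polarised. The dual functionals are defined on the whole type, hence so is
  \<open>g\<close>.\<close>

lemma inner_of_basis:
  fixes X :: "'a::real_vector set"
  assumes b: "basis_of X b"
  obtains g where "inner_on X g" "orthonormal_basis g X b"
proof -
  obtain d :: "nat \<Rightarrow> 'a \<Rightarrow> real" where d: "\<And>j. linear (d j)"
    "\<And>i j. i < dim X \<Longrightarrow> d j (b i) = (if i = j then 1 else 0)"
    "\<And>x. x \<in> X \<Longrightarrow> x = (\<Sum>j<dim X. d j x *\<^sub>R b j)"
    using dual_basis_exists[OF b] by metis
  define g where "g x y = (\<Sum>j<dim X. d j x * d j y)" for x y
  have "linear (g x)" for x unfolding g_def
    by (intro linear_compose_sum ballI linear_compose[OF d(1), of "\<lambda>r. _ * r", unfolded o_def])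
       (simp add: linear_times)
  moreover have "g x y = g y x" for x y unfolding g_def by (simp add: mult.commute)
  moreover have "0 \<le> g x x" for x unfolding g_def by (simp add: sum_nonneg)
  moreover have "x = 0" if "x \<in> X" "g x x = 0" for x
  proof -
    have "\<forall>j\<in>{..<dim X}. d j x * d j x = 0"
      using that(2) unfolding g_def by (subst (asm) sum_nonneg_eq_0_iff) auto
    then have "(\<Sum>j<dim X. d j x *\<^sub>R b j) = 0" by simp
    then show ?thesis using d(3)[OF that(1)] by simp
  qed
  ultimately have "inner_on X g" unfolding inner_on_def by blast
  moreover have "g (b i) (b j) = (if i = j then 1 else 0)" if "i < dim X" "j < dim X" for i j
  proof -
    have "g (b i) (b j) = (\<Sum>k<dim X. if i = k then (if j = k then 1 else 0) else 0)"
      unfolding g_def using that d(2) by (intro sum.cong) auto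
    then show ?thesis using that by auto
  qed
  then have "orthonormal_basis g X b" unfolding orthonormal_basis_def using b by blast
  ultimately show ?thesis using that by blast
qed

text \<open>The vector with coordinates \<open>f (c j)\<close> represents \<open>f\<close> on
  \<open>V\<close>. Its norm identifies \<open>frame_form\<close> as the squared dual norm of
  \<open>f\<close> on \<open>V\<close>, which depends on \<open>g\<close> and \<open>V\<close> but
  not on the choice of \<open>c\<close>.\<close>

lemma orthonormal_basis_riesz:
  assumes g: "inner_on X g" and c: "orthonormal_basis g V c" and f: "linear f"
  obtains z where "z \<in> V" "\<And>v. v \<in> V \<Longrightarrow> f v = g z v" "g z z = frame_form {..<dim V} c f"
proof -
  define z where "z = (\<Sum>j<dim V. f (c j) *\<^sub>R c j)"
  have sV: "subspace V" using c basis_of_subspace unfolding orthonormal_basis_def by blast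
  have z: "z \<in> V" unfolding z_def using sV orthonormal_basis_in[OF c]
      by (intro subspace_sum subspace_scale) auto
  have gz: "g z v = (\<Sum>j<dim V. f (c j) * g (c j) v)" for v
    unfolding z_def by (rule inner_on_linear(2)[OF g])
  have v: "f v = g z v" if "v \<in> V" for v
  proof -
    have "f v = (\<Sum>j<dim V. g (c j) v * f (c j))"
      using linear_apply_sum[OF f, of "\<lambda>j. g (c j) v" c "{..<dim V}"]
        orthonormal_basis_expand[OF g c that] by simp
    then show ?thesis by (simp add: gz mult.commute)
  qed
  have sym: "g (c j) z = g z (c j)" for j using g unfolding inner_on_def by blast
  have "g z z = (\<Sum>j<dim V. f (c j) * g (c j) z)" by (rule gz)
  also have "\<dots> = frame_form {..<dim V} c f"
    unfolding frame_form_def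
  proof (rule sum.cong[OF refl])
    fix j assume "j \<in> {..<dim V}"
    then have "f (c j) = g (c j) z" using v[OF orthonormal_basis_in[OF c]] sym[of j] by simp
    then show "f (c j) * g (c j) z = (f (c j))\<^sup>2" by (simp add: power2_eq_square)
  qed
  finally have "g z z = frame_form {..<dim V} c f" .
  with z v that show ?thesis by blast
qed

text \<open>The Riesz vector \<open>y\<close> of \<open>g z\<close> in \<open>V\<close> is the
  orthogonal projection of \<open>z\<close>, and the defect of the inequality is the squared norm of
  \<open>z - y\<close>.\<close>

lemma orthonormal_basis_bessel:
  assumes g: "inner_on X g" and c: "orthonormal_basis g V c"
  shows "(\<Sum>j<dim V. (g z (c j))\<^sup>2) \<le> g z z"
proof -
  obtain y where y: "y \<in> V" "\<And>v. v \<in> V \<Longrightarrow> g z v = g y v" "g y y = frame_form {..<dim V} c (g z)"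
    using orthonormal_basis_riesz[OF g c inner_on_linear(1)[OF g]] by blast
  have sym: "g y z = g z y" using g unfolding inner_on_def by blast
  have "0 \<le> g (z - y) (z - y)" using g unfolding inner_on_def by blast
  also have "\<dots> = g z z - g z y - g y z + g y y"
    using inner_on_linear(3)[OF g] linear_diff[OF inner_on_linear(1)[OF g]] by simp
  also have "\<dots> = g z z - g y y" using y(2)[OF y(1)] sym by simp
  finally show ?thesis using y(3) by (simp add: frame_form_def)
qed

text \<open>Bessel's inequality applied to the vector that represents \<open>f\<close> on
  \<open>X\<close>.\<close>

lemma frame_form_subspace_le:
  assumes g: "inner_on X g" and b: "orthonormal_basis g X b"
    and c: "orthonormal_basis g V c" and "V \<subseteq> X" and f: "linear f"
  shows "frame_form {..<dim V} c f \<le> frame_form {..<dim X} b f"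
proof -
  obtain z where z: "z \<in> X" "\<And>v. v \<in> X \<Longrightarrow> f v = g z v" "g z z = frame_form {..<dim X} b f"
    using orthonormal_basis_riesz[OF g b f] by blast
  have "frame_form {..<dim V} c f = (\<Sum>j<dim V. (g z (c j))\<^sup>2)"
    unfolding frame_form_def using z(2)[OF subsetD[OF assms(4) orthonormal_basis_in[OF c]]] by simp
  then show ?thesis using orthonormal_basis_bessel[OF g c, of z] z(3) by simp
qed

text \<open>
  The form of \<open>V\<close> at \<open>f\<close> is the minimum of the ambient form over all functionals that agree
  with \<open>f\<close> on \<open>V\<close>, which makes it monotone in the ambient form.
\<close>

lemma frame_form_subspace_mono:
  assumes g: "inner_on X g" "orthonormal_basis g X b" "orthonormal_basis g V c"
    and g': "inner_on X g'" "orthonormal_basis g' X b'" "orthonormal_basis g' V c'"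
    and V: "V \<subseteq> X" and f: "linear f"
    and le: "\<And>h. linear h \<Longrightarrow> frame_form {..<dim X} b h \<le> frame_form {..<dim X} b' h"
  shows "frame_form {..<dim V} c f \<le> frame_form {..<dim V} c' f"
proof -
  obtain z where z: "z \<in> V" "\<And>v. v \<in> V \<Longrightarrow> f v = g' z v" "g' z z = frame_form {..<dim V} c' f"
    using orthonormal_basis_riesz[OF g'(1,3) f] by blast
  have lz: "linear (g' z)" by (rule inner_on_linear(1)[OF g'(1)])
  have sym: "g' x y = g' y x" for x y using g'(1) unfolding inner_on_def by blast
  \<comment> \<open>\<open>g' z\<close> is the minimising functional for \<open>g'\<close>: it
    agrees with \<open>f\<close> on \<open>V\<close>, and its ambient form is exactly
    \<open>g' z z\<close>. Replacing \<open>f\<close> by it makes the ambient comparison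
    usable.\<close>
  have "frame_form {..<dim V} c f = frame_form {..<dim V} c (g' z)"
    unfolding frame_form_def using z(2) orthonormal_basis_in[OF g(3)] by (intro sum.cong) auto
  also have "\<dots> \<le> frame_form {..<dim X} b (g' z)"
    by (rule frame_form_subspace_le[OF g V lz])
  also have "\<dots> \<le> frame_form {..<dim X} b' (g' z)" by (rule le[OF lz])
  also have "\<dots> = (\<Sum>j<dim X. g' (b' j) z * g' (b' j) z)"
    unfolding frame_form_def by (intro sum.cong) (simp_all add: power2_eq_square sym[of "b' _" z])
  also have "\<dots> = g' z z"
    using orthonormal_basis_parseval[OF g'(1,2), of z z] z(1) V by auto
  finally show ?thesis using z(3) by simp
qed

section \<open>Projections of a system of subspaces\<close>

text \<open>
  With orthonormal bases \<open>b\<close> of \<open>V\<close> (size \<open>m\<close>) and \<open>c\<close> of \<open>W\<close> (size \<open>n\<close>), this is the trace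
  of the product of the orthogonal projections onto \<open>V\<close> and \<open>W\<close>.
\<close>

definition overlap :: "('a \<Rightarrow> 'a \<Rightarrow> real) \<Rightarrow> nat \<Rightarrow> (nat \<Rightarrow> 'a) \<Rightarrow> nat \<Rightarrow> (nat \<Rightarrow> 'a) \<Rightarrow> real" where
  "overlap g m b n c = (\<Sum>i<m. \<Sum>j<n. (g (b i) (c j))\<^sup>2)"

lemma overlap_nonneg: "overlap g m b n c \<ge> 0"
  unfolding overlap_def by (intro sum_nonneg) simp

lemma overlap_self:
  assumes c: "orthonormal_basis g V c"
  shows "overlap g (dim V) c (dim V) c = dim V"
proof -
  have "(\<Sum>j<dim V. (g (c i) (c j))\<^sup>2) = 1" if "i < dim V" for i
  proof -
    have "(\<Sum>j<dim V. (g (c i) (c j))\<^sup>2) = (\<Sum>j<dim V. if i = j then 1 else 0)"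
      using c that unfolding orthonormal_basis_def by (intro sum.cong) auto
    then show ?thesis using that by simp
  qed
  then show ?thesis unfolding overlap_def by simp
qed

lemma overlap_same_space:
  assumes g: "inner_on X g" and c: "orthonormal_basis g V c" and c': "orthonormal_basis g V c'"
  shows "overlap g (dim V) c (dim V) c' = dim V"
proof -
  have "(\<Sum>j<dim V. (g (c i) (c' j))\<^sup>2) = 1" if "i < dim V" for i
  proof -
    have sym: "g x y = g y x" for x y using g unfolding inner_on_def by blast
    have "g (c i) (c i) = (\<Sum>j<dim V. g (c' j) (c i) * g (c' j) (c i))"
      by (rule orthonormal_basis_parseval[OF g c' orthonormal_basis_in[OF c that]])
    also have "\<dots> = (\<Sum>j<dim V. (g (c i) (c' j))\<^sup>2)"
      by (intro sum.cong refl) (simp add: power2_eq_square sym[of "c' _"])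
    finally show ?thesis using c that unfolding orthonormal_basis_def by simp
  qed
  then show ?thesis unfolding overlap_def by simp
qed

text \<open>
  Expand \<open>tr ((P - 3/2 * Q)^2) \<ge> 0\<close>, where \<open>P\<close> is the sum of the projections onto the \<open>V i\<close> and \<open>Q\<close>
  is the projection onto \<open>U\<close>.
\<close>

lemma overlap_sum_ge:
  fixes V :: "'i \<Rightarrow> 'a::real_vector set"
  assumes g: "inner_on X g" and I: "finite I"
    and c: "\<And>i. i \<in> I \<Longrightarrow> orthonormal_basis g (V i) (c i)" and VU: "\<And>i. i \<in> I \<Longrightarrow> V i \<subseteq> U"
    and u: "orthonormal_basis g U u"
  shows "(\<Sum>i\<in>I. \<Sum>j\<in>I. overlap g (dim (V i)) (c i) (dim (V j)) (c j))
           \<ge> 3 * real (\<Sum>i\<in>I. dim (V i)) - 9 / 4 * real (dim U)"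
proof -
  define K where "K = (SIGMA i:I. {..<dim (V i)})"
  define v where "v k = c (fst k) (snd k)" for k
  define m where "m = dim U"
  have vU: "v k \<in> U" if kK: "k \<in> K" for k
  proof -
    obtain i s where k: "k = (i, s)" "i \<in> I" "s < dim (V i)" using kK unfolding K_def by auto
    then have "c i s \<in> V i" using orthonormal_basis_in[OF c] by simp
    then show ?thesis using VU[OF k(2)] k(1) by (auto simp: v_def)
  qed
  have par: "g (v k) (v l) = (\<Sum>x<m. g (u x) (v k) * g (u x) (v l))" if "k \<in> K" for k l
    unfolding m_def by (rule orthonormal_basis_parseval[OF g u vU[OF that]])
  have gvv: "g (v k) (v k) = 1" if kK: "k \<in> K" for k
  proof -
    obtain i s where k: "k = (i, s)" "i \<in> I" "s < dim (V i)" using kK unfolding K_def by auto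
    then show ?thesis using c[OF k(2)] by (simp add: v_def orthonormal_basis_def)
  qed
  \<comment> \<open>\<open>M\<close> is the matrix, in the basis \<open>u\<close>, of the sum of the
    projections. Its trace counts all basis vectors, and the trace of its square is the sum of all
    overlaps.\<close>
  define M where "M x y = (\<Sum>k\<in>K. g (u x) (v k) * g (u y) (v k))" for x y
  have tr: "(\<Sum>x<m. M x x) = card K"
  proof -
    have "(\<Sum>x<m. M x x) = (\<Sum>k\<in>K. \<Sum>x<m. g (u x) (v k) * g (u x) (v k))"
      unfolding M_def by (rule sum.swap)
    also have "\<dots> = (\<Sum>k\<in>K. 1)" using par gvv by (intro sum.cong refl) simp
    finally show ?thesis by simp
  qed
  have tr2: "(\<Sum>x<m. \<Sum>y<m. (M x y)\<^sup>2) = (\<Sum>k\<in>K. \<Sum>l\<in>K. (g (v k) (v l))\<^sup>2)"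
  proof -
    let ?a = "\<lambda>x k. g (u x) (v k)"
    have "(\<Sum>k\<in>K. \<Sum>l\<in>K. (g (v k) (v l))\<^sup>2)
        = (\<Sum>k\<in>K. \<Sum>l\<in>K. \<Sum>x<m. \<Sum>y<m. (?a x k * ?a x l) * (?a y k * ?a y l))"
      using par by (intro sum.cong refl) (simp add: power2_eq_square sum_product)
    also have "\<dots> = (\<Sum>k\<in>K. \<Sum>x<m. \<Sum>l\<in>K. \<Sum>y<m. (?a x k * ?a x l) * (?a y k * ?a y l))"
      by (intro sum.cong refl sum.swap)
    also have "\<dots> = (\<Sum>x<m. \<Sum>k\<in>K. \<Sum>l\<in>K. \<Sum>y<m. (?a x k * ?a x l) * (?a y k * ?a y l))"
      by (rule sum.swap)
    also have "\<dots> = (\<Sum>x<m. \<Sum>k\<in>K. \<Sum>y<m. \<Sum>l\<in>K. (?a x k * ?a x l) * (?a y k * ?a y l))"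
      by (intro sum.cong refl sum.swap)
    also have "\<dots> = (\<Sum>x<m. \<Sum>y<m. \<Sum>k\<in>K. \<Sum>l\<in>K. (?a x k * ?a x l) * (?a y k * ?a y l))"
      by (intro sum.cong refl sum.swap)
    also have "\<dots> = (\<Sum>x<m. \<Sum>y<m. (M x y)\<^sup>2)"
      unfolding M_def power2_eq_square sum_product by (intro sum.cong refl) (simp add: mult_ac)
    finally show ?thesis by simp
  qed
  have sumK: "(\<Sum>k\<in>K. h k) = (\<Sum>i\<in>I. \<Sum>s<dim (V i). h (i, s))" for h :: "'i \<times> nat \<Rightarrow> real"
    unfolding K_def using I by (simp add: sum.Sigma)
  have split: "(\<Sum>k\<in>K. \<Sum>l\<in>K. (g (v k) (v l))\<^sup>2)
      = (\<Sum>i\<in>I. \<Sum>j\<in>I. overlap g (dim (V i)) (c i) (dim (V j)) (c j))"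
  proof -
    have "(\<Sum>k\<in>K. \<Sum>l\<in>K. (g (v k) (v l))\<^sup>2)
        = (\<Sum>i\<in>I. \<Sum>s<dim (V i). \<Sum>j\<in>I. \<Sum>t<dim (V j). (g (c i s) (c j t))\<^sup>2)"
      by (simp add: sumK v_def)
    also have "\<dots> = (\<Sum>i\<in>I. \<Sum>j\<in>I. \<Sum>s<dim (V i). \<Sum>t<dim (V j). (g (c i s) (c j t))\<^sup>2)"
      by (intro sum.cong refl sum.swap)
    finally show ?thesis unfolding overlap_def .
  qed
  have cK: "card K = (\<Sum>i\<in>I. dim (V i))" unfolding K_def using I by simp
  \<comment> \<open>The constant 3/2 is the mean eigenvalue of \<open>M\<close> when spaces of total
    dimension \<open>r\<close> lie in a space of dimension \<open>2/3 * r\<close>, the extremal case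
    for triples.\<close>
  have "0 \<le> (\<Sum>x<m. \<Sum>y<m. (M x y - (if x = y then 3 / 2 else 0))\<^sup>2)"
    by (intro sum_nonneg) simp
  also have "\<dots> = (\<Sum>x<m. \<Sum>y<m. (M x y)\<^sup>2 + (if x = y then 9 / 4 - 3 * M x x else 0))"
    by (intro sum.cong refl) (auto simp: power2_eq_square algebra_simps)
  also have "\<dots> = (\<Sum>x<m. \<Sum>y<m. (M x y)\<^sup>2) + 9 / 4 * m - 3 * (\<Sum>x<m. M x x)"
    by (simp add: sum.distrib sum_subtractf sum_distrib_left)
  finally show ?thesis using tr tr2 split cK unfolding m_def by simp
qed

text \<open>The span \<open>U\<close> of the three spaces lies in each of the three pairwise sums,
  so \<open>3 * dim U\<close> is at most \<open>2 * r\<close> for the total dimension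
  \<open>r\<close>. Then \<open>overlap_sum_ge\<close> gives at least \<open>3/2 * r\<close>, of
  which the diagonal accounts for \<open>r\<close>. The remaining \<open>r / 2\<close> is spread
  over ordered pairs.\<close>

lemma overlap_triple_ge:
  fixes V :: "nat \<Rightarrow> 'a::real_vector set"
  assumes g: "inner_on X g"
    and V: "\<And>i. i \<in> T \<Longrightarrow> subspace (V i) \<and> fin_dim (V i) \<and> V i \<subseteq> X"
    and X: "subspace X"
    and c: "\<And>i. i \<in> T \<Longrightarrow> orthonormal_basis g (V i) (c i)"
    and T: "T = {i1, i2, i3}" "card T = 3"
    and dep: "V i1 \<subseteq> V i2 + V i3" "V i2 \<subseteq> V i1 + V i3" "V i3 \<subseteq> V i1 + V i2"
  shows "(\<Sum>i\<in>T. \<Sum>j\<in>T - {i}. overlap g (dim (V i)) (c i) (dim (V j)) (c j))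
           \<ge> real (\<Sum>i\<in>T. dim (V i)) / 2"
proof -
  let ?o = "\<lambda>i j. overlap g (dim (V i)) (c i) (dim (V j)) (c j)"
  have d: "i1 \<noteq> i2" "i1 \<noteq> i3" "i2 \<noteq> i3" using T by (auto simp: card_insert_if split: if_splits)
  have fT: "finite T" using T by simp
  define U where "U = span (\<Union>i\<in>T. V i)"
  have sU: "subspace U" unfolding U_def by simp
  have fU: "fin_dim U" unfolding U_def using fT V by (intro fin_dim_span_UN) auto
  have UX: "U \<subseteq> X" unfolding U_def using V X by (intro span_minimal) auto
  have VU: "V i \<subseteq> U" if "i \<in> T" for i unfolding U_def using that by (auto intro: span_base)
  obtain u where u: "orthonormal_basis g U u" using orthonormal_basis_exists[OF g sU fU UX] by blast
  have sub: "U \<subseteq> A + B" if "subspace A" "subspace B" "A \<union> B \<union> V k \<subseteq> A + B"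
    "(\<Union>i\<in>T. V i) = A \<union> B \<union> V k" for A B k
  proof -
    have "A + B = {x + y |x y. x \<in> A \<and> y \<in> B}" by (auto simp: set_plus_def)
    then have "subspace (A + B)" using subspace_sums[OF that(1,2)] by simp
    then show ?thesis unfolding U_def using that by (intro span_minimal) auto
  qed
  have incl: "V i \<union> V j \<subseteq> V i + V j" if "i \<in> T" "j \<in> T" for i j
  proof -
    have "0 \<in> V i" "0 \<in> V j" using V that subspace_0 by auto
    then show ?thesis
      using set_zero_plus2[of "V i" "V j"] set_zero_plus2[of "V j" "V i"] by (auto simp: add.commute)
  qed
  have dU: "dim U \<le> dim (V i) + dim (V j)" if "U \<subseteq> V i + V j" "i \<in> T" "j \<in> T" for i j
    using dim_le_dim_add_dim[OF that(1)] V that by blast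
  have "U \<subseteq> V i1 + V i2"
    by (rule sub[of _ _ i3]) (use V incl[of i1 i2] dep T in auto)
  then have 1: "dim U \<le> dim (V i1) + dim (V i2)" using dU T by blast
  have "U \<subseteq> V i1 + V i3"
    by (rule sub[of _ _ i2]) (use V incl[of i1 i3] dep T in auto)
  then have 2: "dim U \<le> dim (V i1) + dim (V i3)" using dU T by blast
  have "U \<subseteq> V i2 + V i3"
    by (rule sub[of _ _ i1]) (use V incl[of i2 i3] dep T in auto)
  then have 3: "dim U \<le> dim (V i2) + dim (V i3)" using dU T by blast
  have R: "(\<Sum>i\<in>T. dim (V i)) = dim (V i1) + dim (V i2) + dim (V i3)" using d T by simp
  have "real (3 * dim U) \<le> real (2 * (\<Sum>i\<in>T. dim (V i)))" using 1 2 3 R by (intro of_nat_mono) linarith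
  then have U3: "3 * real (dim U) \<le> 2 * real (\<Sum>i\<in>T. dim (V i))" by simp
  have "(\<Sum>i\<in>T. \<Sum>j\<in>T. ?o i j) \<ge> 3 * real (\<Sum>i\<in>T. dim (V i)) - 9 / 4 * real (dim U)"
    by (rule overlap_sum_ge[OF g fT c VU u])
  moreover have "(\<Sum>i\<in>T. \<Sum>j\<in>T. ?o i j) = (\<Sum>i\<in>T. dim (V i) + (\<Sum>j\<in>T - {i}. ?o i j))"
  proof (intro sum.cong refl)
    fix i assume "i \<in> T"
    then show "(\<Sum>j\<in>T. ?o i j) = dim (V i) + (\<Sum>j\<in>T - {i}. ?o i j)"
      using sum.remove[OF fT, of i "?o i"] overlap_self[OF c] by simp
  qed
  ultimately show ?thesis using U3 by (simp add: sum.distrib)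
qed

text \<open>Equal spaces overlap fully, so the two ordered pairs contribute the whole total
  dimension. The weaker bound is stated to match that for triples.\<close>

lemma overlap_pair_ge:
  fixes V :: "nat \<Rightarrow> 'a::real_vector set"
  assumes g: "inner_on X g"
    and c: "\<And>i. i \<in> T \<Longrightarrow> orthonormal_basis g (V i) (c i)"
    and T: "T = {i1, i2}" "card T = 2" and eq: "V i1 = V i2"
  shows "(\<Sum>i\<in>T. \<Sum>j\<in>T - {i}. overlap g (dim (V i)) (c i) (dim (V j)) (c j))
           \<ge> real (\<Sum>i\<in>T. dim (V i)) / 2"
proof -
  have d: "i1 \<noteq> i2" using T by (auto simp: card_insert_if split: if_splits)
  have c2: "orthonormal_basis g (V i2) (c i1)" "orthonormal_basis g (V i2) (c i2)"
    using c[of i1] c[of i2] T eq by auto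
  have "T - {i1} = {i2}" "T - {i2} = {i1}" using d T by auto
  then show ?thesis using d T eq overlap_same_space[OF g c2] overlap_same_space[OF g c2(2,1)] by simp
qed

section \<open>Double counting over the sets of a system\<close>

lemma sum_list_if_const:
  "(\<Sum>T\<leftarrow>S. if P T then (a::real) else 0) = real (length (filter P S)) * a"
  by (induction S) (auto simp: algebra_simps)

lemma sum_list_sum_swap:
  "(\<Sum>T\<leftarrow>S. \<Sum>i\<in>I. h T i) = (\<Sum>i\<in>I. \<Sum>T\<leftarrow>S. (h T i :: real))"
  by (induction S) (auto simp: sum.distrib)

lemma alpha_delta_systemD:
  assumes "alpha_delta_system \<alpha> \<delta> V S"
  shows "T \<in> set S \<Longrightarrow> T \<subseteq> {..<length V}"
    and "T \<in> set S \<Longrightarrow> card T = 3 \<or> card T = 2"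
    and "T \<in> set S \<Longrightarrow> card T = 3 \<Longrightarrow> T = {i1, i2, i3} \<Longrightarrow>
      V ! i1 \<subseteq> V ! i2 + V ! i3 \<and> V ! i2 \<subseteq> V ! i1 + V ! i3 \<and> V ! i3 \<subseteq> V ! i1 + V ! i2"
    and "T \<in> set S \<Longrightarrow> card T = 2 \<Longrightarrow> T = {i1, i2} \<Longrightarrow> V ! i1 = V ! i2"
    and "i < length V \<Longrightarrow> \<delta> * real (length V) \<le> real (length (filter (\<lambda>T. i \<in> T) S))"
    and "i < length V \<Longrightarrow> j < length V \<Longrightarrow> i \<noteq> j \<Longrightarrow> length (filter (\<lambda>T. {i, j} \<subseteq> T) S) \<le> \<alpha>"
proof -
  note a = assms[unfolded alpha_delta_system_def]
  note b = a[THEN conjunct2]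
  note c = b[THEN conjunct2]
  note d = c[THEN conjunct2]
  show "T \<in> set S \<Longrightarrow> T \<subseteq> {..<length V}" "T \<in> set S \<Longrightarrow> card T = 3 \<or> card T = 2"
    using a[THEN conjunct1] by simp_all
  show "V ! i1 \<subseteq> V ! i2 + V ! i3 \<and> V ! i2 \<subseteq> V ! i1 + V ! i3 \<and> V ! i3 \<subseteq> V ! i1 + V ! i2"
    if "T \<in> set S" "card T = 3" "T = {i1, i2, i3}"
    using b[THEN conjunct1, rule_format, OF that(1)] that(2,3) by metis
  show "V ! i1 = V ! i2" if "T \<in> set S" "card T = 2" "T = {i1, i2}"
    using c[THEN conjunct1, rule_format, OF that(1)] that(2,3) by metis
  show "i < length V \<Longrightarrow> \<delta> * real (length V) \<le> real (length (filter (\<lambda>T. i \<in> T) S))"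
    using d[THEN conjunct1] by simp
  show "length (filter (\<lambda>T. {i, j} \<subseteq> T) S) \<le> \<alpha>" if "i < length V" "j < length V" "i \<noteq> j"
    by (rule d[THEN conjunct2, rule_format, OF that])
qed

text \<open>
  The hypothesis \<open>bound\<close> says that the sum of the projections onto the \<open>V ! i\<close> is at most \<open>\<gamma>\<close>
  times the identity.
\<close>

lemma system_projection_bound:
  fixes V :: "'a::real_vector set list"
  assumes sys: "alpha_delta_system \<alpha> \<delta> V S" and g: "inner_on X g" and X: "subspace X"
    and V: "\<And>i. i < length V \<Longrightarrow> subspace (V ! i) \<and> fin_dim (V ! i) \<and> V ! i \<subseteq> X"
    and c: "\<And>i. i < length V \<Longrightarrow> orthonormal_basis g (V ! i) (c i)"
    and bound: "\<And>x. x \<in> X \<Longrightarrow> (\<Sum>i<length V. \<Sum>s<dim (V ! i). (g x (c i s))\<^sup>2) \<le> \<gamma> * g x x"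
    and D: "(\<Sum>i<length V. dim (V ! i)) > 0"
  shows "\<delta> * length V \<le> 2 * real \<alpha> * \<gamma>"
proof -
  define n where "n = length V"
  define r where "r i = real (dim (V ! i))" for i
  define t where "t i j = overlap g (dim (V ! i)) (c i) (dim (V ! j)) (c j)" for i j
  have t0: "t i j \<ge> 0" for i j unfolding t_def by (rule overlap_nonneg)
  have set: "(\<Sum>i\<in>T. r i) / 2 \<le> (\<Sum>i\<in>T. \<Sum>j\<in>T - {i}. t i j)" if "T \<in> set S" for T
  proof -
    have T: "T \<subseteq> {..<n}" "card T = 3 \<or> card T = 2"
      using alpha_delta_systemD(1,2)[OF sys that] unfolding n_def by simp_all
    have cT: "\<And>i. i \<in> T \<Longrightarrow> orthonormal_basis g (V ! i) (c i)" using c T unfolding n_def by auto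
    have VT: "\<And>i. i \<in> T \<Longrightarrow> subspace (V ! i) \<and> fin_dim (V ! i) \<and> V ! i \<subseteq> X"
      using V T unfolding n_def by auto
    from T(2) show ?thesis
    proof
      assume c3: "card T = 3"
      then obtain i1 i2 i3 where i: "T = {i1, i2, i3}" by (auto simp: card_3_iff)
      have "V ! i1 \<subseteq> V ! i2 + V ! i3" "V ! i2 \<subseteq> V ! i1 + V ! i3" "V ! i3 \<subseteq> V ! i1 + V ! i2"
        using alpha_delta_systemD(3)[OF sys that c3 i] by simp_all
      from overlap_triple_ge[OF g VT X cT i c3 this]
      show ?thesis unfolding t_def r_def by simp
    next
      assume c2: "card T = 2"
      then obtain i1 i2 where i: "T = {i1, i2}" by (auto simp: card_2_iff)
      have "V ! i1 = V ! i2"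
        by (rule alpha_delta_systemD(4)[OF sys that c2 i])
      from overlap_pair_ge[OF g cT i c2 this]
      show ?thesis unfolding t_def r_def by simp
    qed
  qed
  have inT: "(\<Sum>i\<in>T. h i) = (\<Sum>i<n. if i \<in> T then h i else 0)" if "T \<in> set S" for T and h :: "nat \<Rightarrow> real"
  proof -
    have "T \<subseteq> {..<n}" using alpha_delta_systemD(1)[OF sys that] unfolding n_def .
    then show ?thesis by (simp add: sum.If_cases Int_absorb1)
  qed
  \<comment> \<open>Double counting weighted by dimension: each index lies in at least
    \<open>\<delta> * n\<close> sets, and each set pays for the dimensions of its members with its
    off-diagonal overlaps.\<close>
  have "\<delta> * n * (\<Sum>i<n. r i) = (\<Sum>i<n. \<delta> * n * r i)" by (rule sum_distrib_left)
  also have "\<dots> \<le> (\<Sum>i<n. real (length (filter (\<lambda>T. i \<in> T) S)) * r i)"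
    using alpha_delta_systemD(5)[OF sys] unfolding n_def r_def
    by (intro sum_mono mult_right_mono) auto
  also have "\<dots> = (\<Sum>T\<leftarrow>S. \<Sum>i<n. if i \<in> T then r i else 0)"
    by (simp add: sum_list_sum_swap sum_list_if_const)
  also have "\<dots> = (\<Sum>T\<leftarrow>S. \<Sum>i\<in>T. r i)"
    using inT by (intro arg_cong[where f = sum_list] map_cong) auto
  also have "\<dots> \<le> (\<Sum>T\<leftarrow>S. 2 * (\<Sum>i\<in>T. \<Sum>j\<in>T - {i}. t i j))"
    using set by (intro sum_list_mono) (simp add: field_simps)
  also have "\<dots> = 2 * (\<Sum>T\<leftarrow>S. \<Sum>i\<in>T. \<Sum>j\<in>T - {i}. t i j)"
    by (simp add: sum_list_const_mult)
  also have "(\<Sum>T\<leftarrow>S. \<Sum>i\<in>T. \<Sum>j\<in>T - {i}. t i j)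
      = (\<Sum>T\<leftarrow>S. \<Sum>i<n. \<Sum>j<n. if {i, j} \<subseteq> T then (if i \<noteq> j then t i j else 0) else 0)"
  proof (intro arg_cong[where f = sum_list] map_cong refl)
    fix T assume T: "T \<in> set S"
    have fT: "finite T" using alpha_delta_systemD(1)[OF sys T] by (metis finite_lessThan finite_subset)
    have "(\<Sum>i\<in>T. \<Sum>j\<in>T - {i}. t i j) = (\<Sum>i\<in>T. \<Sum>j\<in>T. if i \<noteq> j then t i j else 0)"
      using fT by (intro sum.cong refl sum.mono_neutral_cong_left) auto
    also have "\<dots> = (\<Sum>i<n. if i \<in> T then (\<Sum>j<n. if j \<in> T then (if i \<noteq> j then t i j else 0) else 0) else 0)"
      using inT[OF T] by simp
    also have "\<dots> = (\<Sum>i<n. \<Sum>j<n. if {i, j} \<subseteq> T then (if i \<noteq> j then t i j else 0) else 0)"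
      by (intro sum.cong refl) auto
    finally show "(\<Sum>i\<in>T. \<Sum>j\<in>T - {i}. t i j)
      = (\<Sum>i<n. \<Sum>j<n. if {i, j} \<subseteq> T then (if i \<noteq> j then t i j else 0) else 0)" .
  qed
  also have "\<dots> = (\<Sum>i<n. \<Sum>j<n. real (length (filter (\<lambda>T. {i, j} \<subseteq> T) S)) * (if i \<noteq> j then t i j else 0))"
    by (simp only: sum_list_sum_swap sum_list_if_const)
  \<comment> \<open>The bound \<open>\<alpha>\<close> is used for distinct indices. The diagonal is
    0 on the left and is added on the right to complete the trace of the square of the sum of
    projections.\<close>
  also have "\<dots> \<le> (\<Sum>i<n. \<Sum>j<n. real \<alpha> * t i j)"
  proof (intro sum_mono)
    fix i j assume ij: "i \<in> {..<n}" "j \<in> {..<n}"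
    show "real (length (filter (\<lambda>T. {i, j} \<subseteq> T) S)) * (if i \<noteq> j then t i j else 0) \<le> real \<alpha> * t i j"
    proof (cases "i = j")
      case True then show ?thesis using t0 by simp
    next
      case False
      then have "length (filter (\<lambda>T. {i, j} \<subseteq> T) S) \<le> \<alpha>"
        using ij by (intro alpha_delta_systemD(6)[OF sys]) (simp_all add: n_def)
      then show ?thesis using False t0 by (simp add: mult_right_mono)
    qed
  qed
  also have "\<dots> = real \<alpha> * (\<Sum>i<n. \<Sum>j<n. t i j)" by (simp add: sum_distrib_left)
  also have "\<dots> \<le> real \<alpha> * (\<gamma> * (\<Sum>i<n. r i))"
  proof (rule mult_left_mono)
    \<comment> \<open>Group this trace by the unit vectors \<open>c i p\<close>;
      \<open>bound\<close> limits the contribution of each to \<open>\<gamma>\<close>.\<close>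
    have "(\<Sum>i<n. \<Sum>j<n. t i j) = (\<Sum>i<n. \<Sum>p<dim (V ! i). \<Sum>j<n. \<Sum>s<dim (V ! j). (g (c i p) (c j s))\<^sup>2)"
      unfolding t_def overlap_def by (intro sum.cong refl sum.swap)
    also have "\<dots> \<le> (\<Sum>i<n. \<Sum>p<dim (V ! i). \<gamma>)"
    proof (intro sum_mono)
      fix i p assume i: "i \<in> {..<n}" and p: "p \<in> {..<dim (V ! i)}"
      then have ci: "orthonormal_basis g (V ! i) (c i)" using c unfolding n_def by simp
      then have "c i p \<in> V ! i" using p orthonormal_basis_in by auto
      then have "c i p \<in> X" using V i unfolding n_def by auto
      moreover have "g (c i p) (c i p) = 1" using ci p unfolding orthonormal_basis_def by simp
      ultimately show "(\<Sum>j<n. \<Sum>s<dim (V ! j). (g (c i p) (c j s))\<^sup>2) \<le> \<gamma>"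
        using bound[of "c i p"] unfolding n_def by simp
    qed
    also have "\<dots> = \<gamma> * (\<Sum>i<n. r i)" by (simp add: r_def sum_distrib_left mult.commute)
    finally show "(\<Sum>i<n. \<Sum>j<n. t i j) \<le> \<gamma> * (\<Sum>i<n. r i)" .
  qed simp
  finally have "\<delta> * n * (\<Sum>i<n. r i) \<le> (2 * real \<alpha> * \<gamma>) * (\<Sum>i<n. r i)" by simp
  moreover have "(\<Sum>i<n. r i) > 0"
    using D unfolding n_def r_def by (metis of_nat_0_less_iff of_nat_sum)
  ultimately show ?thesis unfolding n_def by (simp add: mult_le_cancel_right)
qed

section \<open>A dense subspace from a degenerating sequence of forms\<close>

lemma finite_bounded_convergent_subseq:
  fixes x :: "'i \<Rightarrow> nat \<Rightarrow> real"
  assumes "finite I" "\<And>i t. i \<in> I \<Longrightarrow> \<bar>x i t\<bar> \<le> K"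
  obtains r L where "strict_mono (r :: nat \<Rightarrow> nat)" "\<And>i. i \<in> I \<Longrightarrow> (\<lambda>t. x i (r t)) \<longlonglongrightarrow> L i"
proof -
  have "\<exists>r L. strict_mono (r :: nat \<Rightarrow> nat) \<and> (\<forall>i\<in>I. (\<lambda>t. x i (r t)) \<longlonglongrightarrow> L i)"
    using assms
  proof (induction I rule: finite_induct)
    case empty
    then show ?case by (intro exI[of _ id]) (auto simp: strict_mono_def)
  next
    case (insert i I)
    then obtain r L where r: "strict_mono (r :: nat \<Rightarrow> nat)" "\<forall>i\<in>I. (\<lambda>t. x i (r t)) \<longlonglongrightarrow> L i"
      by auto
    have "bounded (range (\<lambda>t. x i (r t)))"
      using insert.prems by (auto simp: bounded_iff)
    then obtain l r' where r': "strict_mono (r' :: nat \<Rightarrow> nat)" "((\<lambda>t. x i (r t)) \<circ> r') \<longlonglongrightarrow> l"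
      using bounded_imp_convergent_subsequence by blast
    have "(\<lambda>t. x j ((r \<circ> r') t)) \<longlonglongrightarrow> (L(i := l)) j" if "j \<in> insert i I" for j
    proof (cases "j = i")
      case True then show ?thesis using r'(2) by (simp add: o_def)
    next
      case False
      then have "(\<lambda>t. x j (r t)) \<longlonglongrightarrow> L j" using r(2) that by blast
      from LIMSEQ_subseq_LIMSEQ[OF this r'(1)] show ?thesis using False by (simp add: o_def)
    qed
    then show ?case using strict_mono_o[OF r(1) r'(1)] by blast
  qed
  then show ?thesis using that by blast
qed

text \<open>On \<open>R\<close>, the span of the family \<open>w\<close>, the form of
  \<open>w\<close> comes from an inner product. Relative to it, the form of \<open>v i\<close> is an
  operator with range in \<open>V i \<inter> R\<close> and bounded by the identity, so its trace is
  at most \<open>dim (V i \<inter> R)\<close>. The claim is the trace of the hypothesis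
  \<open>ge\<close>.\<close>

lemma subspace_of_forms_dense:
  fixes V :: "nat \<Rightarrow> 'a::real_vector set" and v :: "nat \<Rightarrow> nat \<Rightarrow> 'a" and w :: "nat \<Rightarrow> 'a"
  assumes V: "\<And>i. i < n \<Longrightarrow> subspace (V i)"
    and v: "\<And>i s. i < n \<Longrightarrow> s < d i \<Longrightarrow> v i s \<in> V i"
    and le: "\<And>i f. i < n \<Longrightarrow> linear f \<Longrightarrow> frame_form {..<d i} (v i) f \<le> frame_form {..<m} w f"
    and ge: "\<And>f. linear f \<Longrightarrow> \<gamma> * frame_form {..<m} w f \<le> (\<Sum>i<n. frame_form {..<d i} (v i) f)"
  shows "\<gamma> * dim (span (w ` {..<m})) \<le> (\<Sum>i<n. real (dim (V i \<inter> span (w ` {..<m}))))"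
proof -
  define R where "R = span (w ` {..<m})"
  define q where "q = frame_form {..<m} w"
  have fR: "fin_dim R" unfolding fin_dim_def R_def by blast
  have sR: "subspace R" unfolding R_def by simp
  obtain b where b: "basis_of R b" "\<And>f. linear f \<Longrightarrow> frame_form {..<dim R} b f = q f"
    using basis_with_frame_form[OF finite_lessThan, of w m] unfolding R_def q_def by metis
  obtain g where g: "inner_on R g" "orthonormal_basis g R b" using inner_of_basis[OF b(1)] by metis
  have lg: "linear (g x)" for x by (rule inner_on_linear(1)[OF g(1)])
  have sym: "g x y = g y x" for x y using g(1) unfolding inner_on_def by blast
  have qg: "q (g x) = g x x" if "x \<in> R" for x
  proof -
    have "q (g x) = (\<Sum>j<dim R. g (b j) x * g (b j) x)"
      using b(2)[OF lg[of x]] unfolding frame_form_def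
      by (simp add: power2_eq_square sym[of x "b _"])
    also have "\<dots> = g x x" using orthonormal_basis_parseval[OF g that] by simp
    finally show ?thesis .
  qed
  \<comment> \<open>A functional that vanishes on \<open>R\<close> has form 0, and by
    \<open>le\<close> it must also vanish on every \<open>v i s\<close>.\<close>
  have vR: "v i s \<in> R" if ii: "i < n" "s < d i" for i s
  proof (rule ccontr)
    assume "v i s \<notin> R"
    then obtain f :: "'a \<Rightarrow> real" where f: "linear f" "\<And>x. x \<in> R \<Longrightarrow> f x = 0" "f (v i s) = 1"
      using separating_functional[OF sR] by metis
    have "f (w j) = 0" if "j < m" for j
      using f(2) that unfolding R_def by (simp add: span_base)
    then have "q f = 0" unfolding q_def frame_form_def by simp
    then have "frame_form {..<d i} (v i) f \<le> 0" using le[OF ii(1) f(1)] unfolding q_def by simp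
    moreover have "(f (v i s))\<^sup>2 \<le> frame_form {..<d i} (v i) f"
      unfolding frame_form_def using ii(2) by (intro member_le_sum) auto
    ultimately show False using f(3) by simp
  qed
  have sum_le: "(\<Sum>s<d i. g (v i s) (v i s)) \<le> dim (V i \<inter> R)" if i: "i < n" for i
  proof -
    obtain u where u: "orthonormal_basis g (V i \<inter> R) u"
      using orthonormal_basis_exists[OF g(1), of "V i \<inter> R"] V[OF i] sR fR
      by (metis fin_dim_subset inf_le2 subspace_inter)
    have "(\<Sum>s<d i. g (v i s) (v i s)) = (\<Sum>s<d i. \<Sum>l<dim (V i \<inter> R). g (u l) (v i s) * g (u l) (v i s))"
      using v[OF i] vR[OF i] by (intro sum.cong refl orthonormal_basis_parseval[OF g(1) u]) auto
    also have "\<dots> = (\<Sum>l<dim (V i \<inter> R). frame_form {..<d i} (v i) (g (u l)))"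
      unfolding frame_form_def by (subst sum.swap) (simp add: power2_eq_square)
    also have "\<dots> \<le> (\<Sum>l<dim (V i \<inter> R). 1)"
    proof (rule sum_mono)
      fix l assume "l \<in> {..<dim (V i \<inter> R)}"
      then have l: "u l \<in> R" "g (u l) (u l) = 1"
        using orthonormal_basis_in[OF u] u unfolding orthonormal_basis_def by auto
      then show "frame_form {..<d i} (v i) (g (u l)) \<le> 1"
        using le[OF i lg[of "u l"]] qg[OF l(1)] unfolding q_def by simp
    qed
    finally show ?thesis by simp
  qed
  have "\<gamma> * dim R = (\<Sum>j<dim R. \<gamma> * q (g (b j)))"
  proof -
    have "q (g (b j)) = 1" if "j < dim R" for j
      using qg[OF orthonormal_basis_in[OF g(2) that]] g(2) that unfolding orthonormal_basis_def by simp
    then show ?thesis by simp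
  qed
  also have "\<dots> \<le> (\<Sum>j<dim R. \<Sum>i<n. frame_form {..<d i} (v i) (g (b j)))"
    using ge[OF lg] unfolding q_def by (intro sum_mono) auto
  also have "\<dots> = (\<Sum>i<n. \<Sum>j<dim R. frame_form {..<d i} (v i) (g (b j)))" by (rule sum.swap)
  also have "\<dots> = (\<Sum>i<n. \<Sum>s<d i. g (v i s) (v i s))"
  proof (rule sum.cong[OF refl])
    fix i assume "i \<in> {..<n}"
    then have i: "i < n" by simp
    have "(\<Sum>j<dim R. frame_form {..<d i} (v i) (g (b j)))
        = (\<Sum>s<d i. \<Sum>j<dim R. g (b j) (v i s) * g (b j) (v i s))"
      unfolding frame_form_def by (subst sum.swap) (simp add: power2_eq_square)
    also have "\<dots> = (\<Sum>s<d i. g (v i s) (v i s))"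
      using vR[OF i] by (intro sum.cong refl orthonormal_basis_parseval[OF g, symmetric]) auto
    finally show "(\<Sum>j<dim R. frame_form {..<d i} (v i) (g (b j))) = (\<Sum>s<d i. g (v i s) (v i s))" .
  qed
  also have "\<dots> \<le> (\<Sum>i<n. real (dim (V i \<inter> R)))" using sum_le by (intro sum_mono) simp
  finally show ?thesis unfolding R_def .
qed

text \<open>
  Cauchy--Schwarz for the positive semidefinite difference of two forms, obtained by summing its
  values at \<open>a k * e l - a l * e k\<close> over all pairs.
\<close>

lemma form_difference_le_trace:
  fixes X :: "'a::real_vector set"
  assumes X: "basis_of X e" and ed: "\<And>j. linear (ed j)"
      "\<And>x. x \<in> X \<Longrightarrow> x = (\<Sum>j<dim X. ed j x *\<^sub>R e j)"
    and w: "\<And>j. j < dim X \<Longrightarrow> w j \<in> X" and v: "\<And>j. j < dim X \<Longrightarrow> v j \<in> X"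
    and le: "\<And>f. linear f \<Longrightarrow> frame_form {..<dim X} v f \<le> frame_form {..<dim X} w f"
    and f: "linear f"
  shows "frame_form {..<dim X} w f - frame_form {..<dim X} v f
    \<le> (\<Sum>l<dim X. frame_form {..<dim X} w (ed l) - frame_form {..<dim X} v (ed l)) * frame_form {..<dim X} e f"
proof -
  define m where "m = dim X"
  define a where "a l = f (e l)" for l
  define H where "H l k = (\<Sum>j<m. ed l (w j) * ed k (w j)) - (\<Sum>j<m. ed l (v j) * ed k (v j))" for l k
  have fx: "f x = (\<Sum>l<m. a l * ed l x)" if "x \<in> X" for x
  proof -
    have "f x = f (\<Sum>j<m. ed j x *\<^sub>R e j)" using ed(2)[OF that] unfolding m_def by simp
    also have "\<dots> = (\<Sum>l<m. a l * ed l x)"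
      unfolding linear_apply_sum[OF f] a_def by (simp add: mult.commute)
    finally show ?thesis .
  qed
  have ff: "frame_form {..<m} u f = (\<Sum>l<m. \<Sum>k<m. a l * a k * (\<Sum>j<m. ed l (u j) * ed k (u j)))"
    if "\<And>j. j < m \<Longrightarrow> u j \<in> X" for u
  proof -
    have "frame_form {..<m} u f = (\<Sum>j<m. \<Sum>l<m. \<Sum>k<m. a l * ed l (u j) * (a k * ed k (u j)))"
      unfolding frame_form_def using fx[OF that] by (simp add: power2_eq_square sum_product)
    also have "\<dots> = (\<Sum>l<m. \<Sum>j<m. \<Sum>k<m. a l * ed l (u j) * (a k * ed k (u j)))" by (rule sum.swap)
    also have "\<dots> = (\<Sum>l<m. \<Sum>k<m. \<Sum>j<m. a l * ed l (u j) * (a k * ed k (u j)))"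
      by (intro sum.cong refl sum.swap)
    also have "\<dots> = (\<Sum>l<m. \<Sum>k<m. a l * a k * (\<Sum>j<m. ed l (u j) * ed k (u j)))"
      by (simp add: sum_distrib_left mult_ac)
    finally show ?thesis .
  qed
  have hf: "frame_form {..<m} w f - frame_form {..<m} v f = (\<Sum>l<m. \<Sum>k<m. a l * a k * H l k)"
    using ff[of w] ff[of v] w v unfolding H_def m_def
    by (simp add: sum_subtractf right_diff_distrib)
  have hd: "H l l = frame_form {..<m} w (ed l) - frame_form {..<m} v (ed l)" for l
    unfolding H_def frame_form_def by (simp add: power2_eq_square)
  have pos: "0 \<le> (a k)\<^sup>2 * H l l - 2 * (a l * a k * H l k) + (a l)\<^sup>2 * H k k" for l k
  proof -
    define h where "h x = a k * ed l x - a l * ed k x" for x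
    have "linear h"
      unfolding h_def
      by (intro linear_compose_sub linear_compose[OF ed(1), of "\<lambda>r. _ * r", unfolded o_def])
        (simp_all add: linear_times)
    then have "0 \<le> frame_form {..<m} w h - frame_form {..<m} v h" using le[of h] unfolding m_def by simp
    also have "frame_form {..<m} w h - frame_form {..<m} v h =
        (a k)\<^sup>2 * H l l - 2 * (a l * a k * H l k) + (a l)\<^sup>2 * H k k"
    proof -
      have F: "frame_form {..<m} u h = (a k)\<^sup>2 * (\<Sum>j<m. ed l (u j) * ed l (u j))
          - 2 * (a l * a k * (\<Sum>j<m. ed l (u j) * ed k (u j))) + (a l)\<^sup>2 * (\<Sum>j<m. ed k (u j) * ed k (u j))" for u
        unfolding frame_form_def h_def sum_distrib_left sum_subtractf[symmetric] sum.distrib[symmetric]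
        by (intro sum.cong refl) (simp add: power2_eq_square algebra_simps)
      show ?thesis using F[of w] F[of v] unfolding H_def by (simp add: algebra_simps)
    qed
    finally show ?thesis .
  qed
  have "0 \<le> (\<Sum>l<m. \<Sum>k<m. (a k)\<^sup>2 * H l l - 2 * (a l * a k * H l k) + (a l)\<^sup>2 * H k k)"
    using pos by (intro sum_nonneg) auto
  also have "\<dots> = (\<Sum>l<m. \<Sum>k<m. (a k)\<^sup>2 * H l l) - 2 * (\<Sum>l<m. \<Sum>k<m. a l * a k * H l k)
      + (\<Sum>l<m. \<Sum>k<m. (a l)\<^sup>2 * H k k)"
    by (simp add: sum.distrib sum_subtractf sum_distrib_left)
  also have "(\<Sum>l<m. \<Sum>k<m. (a k)\<^sup>2 * H l l) = (\<Sum>l<m. H l l) * (\<Sum>k<m. (a k)\<^sup>2)"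
    by (simp add: sum_product mult.commute)
  also have "(\<Sum>l<m. \<Sum>k<m. (a l)\<^sup>2 * H k k) = (\<Sum>l<m. H l l) * (\<Sum>k<m. (a k)\<^sup>2)"
    unfolding sum_product by (subst sum.swap) (simp add: mult.commute)
  finally have "(\<Sum>l<m. \<Sum>k<m. a l * a k * H l k) \<le> (\<Sum>l<m. H l l) * (\<Sum>k<m. (a k)\<^sup>2)" by simp
  moreover have "(\<Sum>k<m. (a k)\<^sup>2) = frame_form {..<m} e f" unfolding a_def frame_form_def ..
  ultimately show ?thesis using hf hd unfolding m_def by simp
qed

section \<open>The increasing iteration of forms\<close>

text \<open>The inner product is hidden behind the bases: \<open>b\<close> determines it on
  \<open>X\<close>, and \<open>c i\<close> then represents the form induced on \<open>V i\<close>.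
  The iteration can thus be run on bases alone.\<close>

definition compatible_bases :: "'a::real_vector set \<Rightarrow> nat \<Rightarrow> (nat \<Rightarrow> 'a set) \<Rightarrow> (nat \<Rightarrow> 'a) \<Rightarrow> (nat \<Rightarrow> nat \<Rightarrow> 'a) \<Rightarrow> bool" where
  "compatible_bases X n V b c \<longleftrightarrow> (\<exists>g. inner_on X g \<and> orthonormal_basis g X b \<and>
     (\<forall>i<n. orthonormal_basis g (V i) (c i)))"

lemma compatible_bases_exists:
  assumes b: "basis_of X b" and V: "\<And>i. i < n \<Longrightarrow> subspace (V i) \<and> V i \<subseteq> X"
  shows "\<exists>c. compatible_bases X n V b c"
proof -
  obtain g where g: "inner_on X g" "orthonormal_basis g X b" using inner_of_basis[OF b] by metis
  have "\<exists>c. orthonormal_basis g (V i) c" if "i < n" for i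
    using orthonormal_basis_exists[OF g(1), of "V i"] V[OF that]
      fin_dim_subset[OF _ basis_of_fin_dim[OF b], of "V i"] by metis
  then obtain c where "\<And>i. i < n \<Longrightarrow> orthonormal_basis g (V i) (c i)" by metis
  with g show ?thesis unfolding compatible_bases_def by blast
qed

text \<open>The right-hand side divided by \<open>\<gamma>\<close> is the form of one finite family,
  all \<open>c i s\<close> and \<open>e j\<close> scaled by \<open>1 / sqrt \<gamma>\<close>. The
  index set is a disjoint sum, so repeated vectors keep their multiplicity, and the
  \<open>e j\<close> make the family span \<open>X\<close>; \<open>basis_with_frame_form\<close>
  does the rest.\<close>

lemma next_form:
  fixes X :: "'a::real_vector set" and c :: "nat \<Rightarrow> nat \<Rightarrow> 'a"
  assumes e: "basis_of X e" and \<gamma>: "\<gamma> > 0"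
    and c: "\<And>i s. i < n \<Longrightarrow> s < d i \<Longrightarrow> c i s \<in> X"
  shows "\<exists>b. basis_of X b \<and> (\<forall>f. linear f \<longrightarrow>
    \<gamma> * frame_form {..<dim X} b f = (\<Sum>i<n. frame_form {..<d i} (c i) f) + frame_form {..<dim X} e f)"
proof -
  define K where "K = (SIGMA i:{..<n}. {..<d i})"
  define I where "I = K <+> {..<dim X}"
  define k where "k = 1 / sqrt \<gamma>"
  have k: "k \<noteq> 0" "k\<^sup>2 = 1 / \<gamma>" using \<gamma> by (auto simp: k_def power_divide)
  define w where "w = case_sum (\<lambda>p. k *\<^sub>R c (fst p) (snd p)) (\<lambda>j. k *\<^sub>R e j)"
  have fI: "finite K" "finite I" unfolding I_def K_def by auto
  have sX: "subspace X" by (rule basis_of_subspace[OF e])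
  have "w ` I \<subseteq> X"
  proof -
    have "w p \<in> X" if "p \<in> I" for p
      using that subspace_scale[OF sX c] subspace_scale[OF sX basis_of_in[OF e]]
      unfolding I_def K_def w_def by (auto split: sum.split)
    then show ?thesis by auto
  qed
  then have "span (w ` I) \<subseteq> X" using sX by (rule span_minimal)
  moreover have "X \<subseteq> span (w ` I)"
  proof -
    have "e j \<in> span (w ` I)" if "j < dim X" for j
    proof -
      have "w (Inr j) \<in> span (w ` I)" using that unfolding I_def by (intro span_base imageI InrI) simp
      then have "(1 / k) *\<^sub>R w (Inr j) \<in> span (w ` I)" by (rule span_scale)
      then show ?thesis using k(1) by (simp add: w_def)
    qed
    then have "span (e ` {..<dim X}) \<subseteq> span (w ` I)" by (intro span_minimal) auto
    then show ?thesis using e by (simp add: basis_of_def)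
  qed
  ultimately have sp: "span (w ` I) = X" by (rule subset_antisym)
  obtain b where b: "basis_of X b" "\<And>f. linear f \<Longrightarrow> frame_form {..<dim X} b f = frame_form I w f"
    using basis_with_frame_form[OF fI(2), of w] unfolding sp by metis
  have "\<gamma> * frame_form {..<dim X} b f = (\<Sum>i<n. frame_form {..<d i} (c i) f) + frame_form {..<dim X} e f"
    if f: "linear f" for f
  proof -
    have fs: "(f (k *\<^sub>R x))\<^sup>2 = (f x)\<^sup>2 / \<gamma>" for x
      using linear_scale[OF f] k(2) by (simp add: power_mult_distrib)
    have "frame_form I w f = (\<Sum>p\<in>K. (f (w (Inl p)))\<^sup>2) + (\<Sum>j<dim X. (f (w (Inr j)))\<^sup>2)"
      unfolding frame_form_def I_def using fI(1) by (simp add: sum.Plus)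
    also have "\<dots> = (\<Sum>p\<in>K. (f (c (fst p) (snd p)))\<^sup>2) / \<gamma> + (\<Sum>j<dim X. (f (e j))\<^sup>2) / \<gamma>"
      by (simp add: w_def fs sum_divide_distrib)
    also have "(\<Sum>p\<in>K. (f (c (fst p) (snd p)))\<^sup>2) = (\<Sum>i<n. \<Sum>s<d i. (f (c i s))\<^sup>2)"
      unfolding K_def by (simp add: sum.Sigma split_def)
    finally show ?thesis using b(2)[OF f] \<gamma> unfolding frame_form_def by (simp add: field_simps)
  qed
  with b(1) show ?thesis by blast
qed

text \<open>\<open>B t\<close> represents the form at time \<open>t\<close>, \<open>c t i\<close>
  the form it induces on \<open>V i\<close>, and \<open>e\<close> the fixed form added at each
  step.\<close>

definition form_iteration ::
    "'a::real_vector set \<Rightarrow> (nat \<Rightarrow> 'a) \<Rightarrow> real \<Rightarrow> nat \<Rightarrow> (nat \<Rightarrow> 'a set) \<Rightarrow>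
     (nat \<Rightarrow> nat \<Rightarrow> 'a) \<Rightarrow> (nat \<Rightarrow> nat \<Rightarrow> nat \<Rightarrow> 'a) \<Rightarrow> bool" where
  "form_iteration X e \<gamma> n V B c \<longleftrightarrow>
     (\<forall>t. basis_of X (B t)) \<and> (\<forall>t. compatible_bases X n V (B t) (c t)) \<and>
     (\<forall>t f. linear f \<longrightarrow> \<gamma> * frame_form {..<dim X} (B (Suc t)) f
       = (\<Sum>i<n. frame_form {..<dim (V i)} (c t i) f) + frame_form {..<dim X} e f) \<and>
     (\<forall>t f. linear f \<longrightarrow> frame_form {..<dim X} (B t) f \<le> frame_form {..<dim X} (B (Suc t)) f) \<and>
     (\<forall>t f. linear f \<longrightarrow> frame_form {..<dim X} e f \<le> \<gamma> * frame_form {..<dim X} (B t) f)"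

lemma form_iterationD:
  assumes "form_iteration X e \<gamma> n V B c"
  shows "basis_of X (B t)" "compatible_bases X n V (B t) (c t)"
    "linear f \<Longrightarrow> \<gamma> * frame_form {..<dim X} (B (Suc t)) f
       = (\<Sum>i<n. frame_form {..<dim (V i)} (c t i) f) + frame_form {..<dim X} e f"
    "linear f \<Longrightarrow> frame_form {..<dim X} (B t) f \<le> frame_form {..<dim X} (B (Suc t)) f"
    "linear f \<Longrightarrow> frame_form {..<dim X} e f \<le> \<gamma> * frame_form {..<dim X} (B t) f"
  using assms unfolding form_iteration_def by simp_all

text \<open>Monotonicity is an induction on \<open>t\<close>. The first step only adds nonnegative
  forms, and afterwards a larger form induces larger forms on all \<open>V i\<close> by
  \<open>frame_form_subspace_mono\<close>, hence a larger successor.\<close>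

lemma form_iteration_exists:
  fixes V :: "nat \<Rightarrow> 'a::real_vector set"
  assumes e: "basis_of X e" and \<gamma>: "\<gamma> > 0" and V: "\<And>i. i < n \<Longrightarrow> subspace (V i) \<and> V i \<subseteq> X"
  shows "\<exists>B c. form_iteration X e \<gamma> n V B c"
proof -
  define q where "q b = frame_form {..<dim X} b" for b :: "nat \<Rightarrow> 'a"
  define s where "s c f = (\<Sum>i<n. frame_form {..<dim (V i)} (c i) f)" for c :: "nat \<Rightarrow> nat \<Rightarrow> 'a" and f
  have s0: "s c f \<ge> 0" for c f unfolding s_def by (intro sum_nonneg frame_form_nonneg)
  have "\<forall>b. \<exists>c. basis_of X b \<longrightarrow> compatible_bases X n V b c"
    using compatible_bases_exists[of X _ n V] V by blast
  then obtain C where C: "\<And>b. basis_of X b \<Longrightarrow> compatible_bases X n V b (C b)" by metis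
  have "\<exists>b'. basis_of X b \<longrightarrow> basis_of X b' \<and> (\<forall>f. linear f \<longrightarrow> \<gamma> * q b' f = s (C b) f + q e f)" for b
  proof (cases "basis_of X b")
    case True
    have "C b i j \<in> X" if "i < n" "j < dim (V i)" for i j
    proof -
      have "\<exists>g. orthonormal_basis g (V i) (C b i)"
        using C[OF True] that(1) unfolding compatible_bases_def by blast
      then show ?thesis using orthonormal_basis_in that(2) V[OF that(1)] by blast
    qed
    from next_form[OF e \<gamma>, of n "\<lambda>i. dim (V i)" "C b", OF this]
    show ?thesis unfolding q_def s_def by blast
  qed blast
  then obtain N where N: "\<And>b. basis_of X b \<Longrightarrow> basis_of X (N b)"
    "\<And>b f. basis_of X b \<Longrightarrow> linear f \<Longrightarrow> \<gamma> * q (N b) f = s (C b) f + q e f"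
    by metis
  \<comment> \<open>With no subspaces at all, \<open>next_form\<close> yields the starting form,
    that of \<open>e\<close> divided by \<open>\<gamma>\<close>.\<close>
  obtain b0 where b0: "basis_of X b0" "\<And>f. linear f \<Longrightarrow> \<gamma> * q b0 f = q e f"
    using next_form[OF e \<gamma>, of 0 "\<lambda>i. 0" "\<lambda>i j. 0"] unfolding q_def by auto
  define B where "B t = (N ^^ t) b0" for t
  have BS: "B (Suc t) = N (B t)" for t unfolding B_def by simp
  have B: "basis_of X (B t)" for t
    by (induction t) (simp_all add: BS N(1), simp add: B_def b0)
  have rec: "\<gamma> * q (B (Suc t)) f = s (C (B t)) f + q e f" if "linear f" for t f
    unfolding BS by (rule N(2)[OF B that])
  have smono: "s (C b) f \<le> s (C b') f"
    if b: "basis_of X b" and b': "basis_of X b'" and f: "linear f"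
      and le: "\<And>h. linear h \<Longrightarrow> q b h \<le> q b' h" for b b' f
  proof -
    obtain g where g: "inner_on X g" "orthonormal_basis g X b"
      "\<And>i. i < n \<Longrightarrow> orthonormal_basis g (V i) (C b i)"
      using C[OF b] unfolding compatible_bases_def by metis
    obtain g' where g': "inner_on X g'" "orthonormal_basis g' X b'"
      "\<And>i. i < n \<Longrightarrow> orthonormal_basis g' (V i) (C b' i)"
      using C[OF b'] unfolding compatible_bases_def by metis
    have "frame_form {..<dim (V i)} (C b i) f \<le> frame_form {..<dim (V i)} (C b' i) f" if i: "i < n" for i
      using frame_form_subspace_mono[OF g(1,2) g(3)[OF i] g'(1,2) g'(3)[OF i] _ f] V[OF i] le
      unfolding q_def by blast
    then show ?thesis unfolding s_def by (intro sum_mono) simp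
  qed
  have mono: "\<forall>f. linear f \<longrightarrow> q (B t) f \<le> q (B (Suc t)) f" for t
  proof (induction t)
    case 0
    show ?case
    proof (intro allI impI)
      fix f :: "'a \<Rightarrow> real" assume f: "linear f"
      have "\<gamma> * q (B 0) f \<le> \<gamma> * q (B (Suc 0)) f"
        using rec[OF f, of 0] b0(2)[OF f] s0[of "C (B 0)" f] by (simp add: B_def)
      then show "q (B 0) f \<le> q (B (Suc 0)) f" using \<gamma> by simp
    qed
  next
    case (Suc t)
    show ?case
    proof (intro allI impI)
      fix f :: "'a \<Rightarrow> real" assume f: "linear f"
      have "s (C (B t)) f \<le> s (C (B (Suc t))) f" using smono[OF B B f] Suc.IH by blast
      then have "\<gamma> * q (B (Suc t)) f \<le> \<gamma> * q (B (Suc (Suc t))) f"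
        using rec[OF f, of t] rec[OF f, of "Suc t"] by linarith
      then show "q (B (Suc t)) f \<le> q (B (Suc (Suc t))) f" using \<gamma> by simp
    qed
  qed
  have low: "q e f \<le> \<gamma> * q (B t) f" if f: "linear f" for t f
  proof (cases t)
    case 0 then show ?thesis using b0(2)[OF f] by (simp add: B_def)
  next
    case (Suc t') then show ?thesis using rec[OF f, of t'] s0[of "C (B t')" f] by simp
  qed
  have "form_iteration X e \<gamma> n V B (\<lambda>t. C (B t))"
    unfolding form_iteration_def
    using B C[OF B] rec mono low unfolding q_def s_def by simp
  then show ?thesis by blast
qed

section \<open>Divergence of the trace and the degenerate limit\<close>

text \<open>The trace grows by more than a fixed \<open>\<eta>\<close> in each step. Otherwise the
  increase of the form at any \<open>f\<close> is at most \<open>\<eta> * ref f\<close>, which is at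
  most \<open>(\<gamma>' / \<gamma> - 1) * q t f\<close> by the lower bound of the iteration. Then
  \<open>\<gamma> * q (Suc t) f \<le> \<gamma>' * q t f\<close>, against \<open>no\<close>.\<close>

lemma form_trace_unbounded:
  fixes V :: "nat \<Rightarrow> 'a::real_vector set"
  assumes e: "basis_of X e" and ed: "\<And>j. linear (ed j)"
      "\<And>x. x \<in> X \<Longrightarrow> x = (\<Sum>j<dim X. ed j x *\<^sub>R e j)"
    and \<gamma>: "0 < \<gamma>" "\<gamma> < \<gamma>'"
    and it: "form_iteration X e \<gamma> n V B c"
    and no: "\<And>t. \<exists>f. linear f \<and>
       \<gamma>' * frame_form {..<dim X} (B t) f < (\<Sum>i<n. frame_form {..<dim (V i)} (c t i) f)"
  shows "filterlim (\<lambda>t. \<Sum>l<dim X. frame_form {..<dim X} (B t) (ed l)) at_top sequentially"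
proof -
  note B = form_iterationD(1)[OF it] and rec = form_iterationD(3)[OF it]
    and mono = form_iterationD(4)[OF it] and low = form_iterationD(5)[OF it]
  define q where "q t = frame_form {..<dim X} (B t)" for t
  define ref where "ref = frame_form {..<dim X} e"
  define \<tau> where "\<tau> t = (\<Sum>l<dim X. q t (ed l))" for t
  define \<eta> where "\<eta> = (\<gamma>' / \<gamma> - 1) / \<gamma>"
  have \<eta>: "\<eta> > 0" using \<gamma> by (simp add: \<eta>_def)
  have step: "\<tau> (Suc t) - \<tau> t > \<eta>" for t
  proof (rule ccontr)
    assume "\<not> \<tau> (Suc t) - \<tau> t > \<eta>"
    then have small: "\<tau> (Suc t) - \<tau> t \<le> \<eta>" by simp
    obtain f where f: "linear f" "\<gamma>' * q t f < (\<Sum>i<n. frame_form {..<dim (V i)} (c t i) f)"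
      using no[of t] unfolding q_def by blast
    have ref0: "ref f \<ge> 0" unfolding ref_def by (rule frame_form_nonneg)
    have "q (Suc t) f - q t f \<le> (\<Sum>l<dim X. q (Suc t) (ed l) - q t (ed l)) * ref f"
      unfolding q_def ref_def
      by (rule form_difference_le_trace[OF e ed basis_of_in[OF B] basis_of_in[OF B] mono f(1)])
    also have "\<dots> = (\<tau> (Suc t) - \<tau> t) * ref f" by (simp add: \<tau>_def sum_subtractf)
    also have "\<dots> \<le> \<eta> * ref f" using small ref0 by (rule mult_right_mono)
    also have "\<dots> \<le> \<eta> * (\<gamma> * q t f)"
      using low[OF f(1), of t] \<eta> unfolding q_def ref_def by (intro mult_left_mono) auto
    also have "\<dots> = (\<gamma>' / \<gamma> - 1) * q t f" using \<gamma> by (simp add: \<eta>_def)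
    finally have "q (Suc t) f \<le> \<gamma>' / \<gamma> * q t f" by (simp add: algebra_simps)
    then have "\<gamma> * q (Suc t) f \<le> \<gamma> * (\<gamma>' / \<gamma> * q t f)" using \<gamma> by (intro mult_left_mono) auto
    then have "\<gamma> * q (Suc t) f \<le> \<gamma>' * q t f" using \<gamma> by simp
    then show False using f(2) rec[OF f(1), of t] ref0 unfolding q_def ref_def by linarith
  qed
  have "\<tau> t \<ge> \<eta> * real t" for t
  proof (induction t)
    case 0
    show ?case unfolding \<tau>_def q_def by (simp add: sum_nonneg frame_form_nonneg)
  next
    case (Suc t)
    then show ?case using step[of t] by (simp add: algebra_simps)
  qed
  moreover have "filterlim (\<lambda>t. \<eta> * real t) at_top sequentially"
    using \<eta> by (intro filterlim_tendsto_pos_mult_at_top[OF tendsto_const _ filterlim_real_sequentially])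
  ultimately have "filterlim \<tau> at_top sequentially"
    by (auto intro: filterlim_at_top_mono eventuallyI)
  then show ?thesis unfolding \<tau>_def q_def .
qed

text \<open>After division by \<open>sqrt (\<tau> t)\<close> all vectors have coordinates in the
  basis \<open>e\<close> of absolute value at most 1, since the square of a coordinate is one
  summand of a form at \<open>ed l\<close>. There are finitely many coordinates, so one subsequence
  serves all; the convergence is expressed through functionals.\<close>

lemma limit_of_forms:
  fixes c :: "nat \<Rightarrow> 'i \<Rightarrow> nat \<Rightarrow> 'a::real_vector"
  assumes e: "basis_of X e" and ed: "\<And>j. linear (ed j)"
      "\<And>x. x \<in> X \<Longrightarrow> x = (\<Sum>j<dim X. ed j x *\<^sub>R e j)"
    and I: "finite I" and c: "\<And>t i s. i \<in> I \<Longrightarrow> s < d i \<Longrightarrow> c t i s \<in> X"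
    and \<tau>: "\<And>t. \<tau> t > 0"
    and bd: "\<And>t i l. i \<in> I \<Longrightarrow> l < dim X \<Longrightarrow> frame_form {..<d i} (c t i) (ed l) \<le> \<tau> t"
  shows "\<exists>r w. strict_mono (r :: nat \<Rightarrow> nat) \<and> (\<forall>i s. w i s \<in> X) \<and>
    (\<forall>i\<in>I. \<forall>s<d i. \<forall>f. linear f \<longrightarrow> (\<lambda>t. f (c (r t) i s) / sqrt (\<tau> (r t))) \<longlonglongrightarrow> f (w i s)) \<and>
    (\<forall>i\<in>I. \<forall>f. linear f \<longrightarrow>
       (\<lambda>t. frame_form {..<d i} (c (r t) i) f / \<tau> (r t)) \<longlonglongrightarrow> frame_form {..<d i} (w i) f)"
proof -
  define J where "J = {..<dim X} \<times> (SIGMA i:I. {..<d i})"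
  define x where "x p t = ed (fst p) (c t (fst (snd p)) (snd (snd p))) / sqrt (\<tau> t)" for p t
  have fJ: "finite J" unfolding J_def using I by simp
  have "\<bar>x p t\<bar> \<le> 1" if "p \<in> J" for p t
  proof -
    obtain l i s where p: "p = (l, i, s)" "l < dim X" "i \<in> I" "s < d i"
      using \<open>p \<in> J\<close> unfolding J_def by auto
    have "(ed l (c t i s))\<^sup>2 \<le> frame_form {..<d i} (c t i) (ed l)"
      unfolding frame_form_def using p(4) by (intro member_le_sum) auto
    also have "\<dots> \<le> \<tau> t" using bd p by blast
    finally have "\<bar>ed l (c t i s)\<bar> \<le> sqrt (\<tau> t)" by (simp add: real_le_rsqrt)
    then show ?thesis using \<tau>[of t] p(1) by (simp add: x_def)
  qed
  then obtain r L where r: "strict_mono (r :: nat \<Rightarrow> nat)" "\<And>p. p \<in> J \<Longrightarrow> (\<lambda>t. x p (r t)) \<longlonglongrightarrow> L p"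
    using finite_bounded_convergent_subseq[OF fJ, of x 1] by metis
  define w where "w i s = (\<Sum>l<dim X. L (l, i, s) *\<^sub>R e l)" for i s
  have lim: "(\<lambda>t. f (c (r t) i s) / sqrt (\<tau> (r t))) \<longlonglongrightarrow> f (w i s)"
    if i: "i \<in> I" and s: "s < d i" and f: "linear f" for i s f
  proof -
    have eq: "f (c t i s) / sqrt (\<tau> t) = (\<Sum>l<dim X. x (l, i, s) t * f (e l))" for t
    proof -
      have "f (c t i s) = f (\<Sum>l<dim X. ed l (c t i s) *\<^sub>R e l)" using ed(2)[OF c[OF i s]] by simp
      also have "\<dots> = (\<Sum>l<dim X. ed l (c t i s) * f (e l))" by (rule linear_apply_sum[OF f])
      finally show ?thesis by (simp add: x_def sum_divide_distrib)
    qed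
    have "(\<lambda>t. \<Sum>l<dim X. x (l, i, s) (r t) * f (e l)) \<longlonglongrightarrow> (\<Sum>l<dim X. L (l, i, s) * f (e l))"
      using i s by (intro tendsto_sum tendsto_mult tendsto_const r(2)) (simp add: J_def)
    then show ?thesis unfolding eq w_def linear_apply_sum[OF f] .
  qed
  have "w i s \<in> X" for i s
    unfolding w_def using basis_of_subspace[OF e] basis_of_in[OF e]
    by (intro subspace_sum subspace_scale) auto
  moreover have "(\<lambda>t. frame_form {..<d i} (c (r t) i) f / \<tau> (r t)) \<longlonglongrightarrow> frame_form {..<d i} (w i) f"
    if i: "i \<in> I" and f: "linear f" for i f
  proof -
    have "frame_form {..<d i} (c t i) f / \<tau> t = (\<Sum>s<d i. (f (c t i s) / sqrt (\<tau> t))\<^sup>2)" for t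
      using \<tau>[of t] unfolding frame_form_def by (simp add: power_divide sum_divide_distrib)
    moreover have "(\<lambda>t. \<Sum>s<d i. (f (c (r t) i s) / sqrt (\<tau> (r t)))\<^sup>2) \<longlonglongrightarrow> (\<Sum>s<d i. (f (w i s))\<^sup>2)"
      using lim[OF i _ f] by (intro tendsto_sum tendsto_power) simp
    ultimately show ?thesis unfolding frame_form_def[of _ "w i"] by simp
  qed
  ultimately show ?thesis using r(1) lim by (intro exI[of _ r] exI[of _ w]) simp
qed

text \<open>By \<open>no\<close> the trace of the iteration tends to infinity. Dividing by the trace
  therefore removes the fixed form in the limit and leaves exactly the hypotheses of
  \<open>subspace_of_forms_dense\<close>, with \<open>R\<close> the span of the limit
  family.\<close>

lemma dense_subspace_exists:
  fixes V :: "nat \<Rightarrow> 'a::real_vector set"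
  assumes X: "subspace X" "fin_dim X" "dim X > 0"
    and V: "\<And>i. i < n \<Longrightarrow> subspace (V i) \<and> V i \<subseteq> X"
    and \<gamma>: "0 < \<gamma>" "\<gamma> < \<gamma>'"
    and no: "\<And>b c. compatible_bases X n V b c \<Longrightarrow> \<exists>f. linear f \<and>
       \<gamma>' * frame_form {..<dim X} b f < (\<Sum>i<n. frame_form {..<dim (V i)} (c i) f)"
  obtains R where "subspace R" "R \<subseteq> X" "\<exists>x\<in>R. x \<noteq> 0"
    "\<gamma> * dim R \<le> (\<Sum>i<n. real (dim (V i \<inter> R)))"
proof -
  obtain e where e: "basis_of X e" using basis_of_exists[OF X(1,2)] by metis
  obtain ed :: "nat \<Rightarrow> 'a \<Rightarrow> real" where ed: "\<And>j. linear (ed j)"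
    "\<And>i j. i < dim X \<Longrightarrow> ed j (e i) = (if i = j then 1 else 0)"
    "\<And>x. x \<in> X \<Longrightarrow> x = (\<Sum>j<dim X. ed j x *\<^sub>R e j)"
    using dual_basis_exists[OF e] by metis
  obtain B c where it: "form_iteration X e \<gamma> n V B c"
    using form_iteration_exists[where X = X and n = n and V = V, OF e \<gamma>(1) V] by blast
  note B = form_iterationD(1)[OF it] and comp = form_iterationD(2)[OF it]
    and rec = form_iterationD(3)[OF it] and mono = form_iterationD(4)[OF it]
    and low = form_iterationD(5)[OF it]
  define q where "q t = frame_form {..<dim X} (B t)" for t
  define p where "p t i = frame_form {..<dim (V i)} (c t i)" for t i
  define ref where "ref = frame_form {..<dim X} e"
  define \<tau> where "\<tau> t = (\<Sum>l<dim X. q t (ed l))" for t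
  have \<tau>_top: "filterlim \<tau> at_top sequentially"
    unfolding \<tau>_def q_def
    by (rule form_trace_unbounded[OF e ed(1,3) \<gamma> it no[OF comp]])
  have \<tau>0: "\<tau> t > 0" for t
  proof -
    have "q t (ed l) > 0" if l: "l < dim X" for l
    proof -
      have "1 \<le> ref (ed l)"
        unfolding ref_def frame_form_def using ed(2)[OF l, of l] l
        by (intro order_trans[OF _ member_le_sum[of l]]) auto
      then have "0 < \<gamma> * q t (ed l)" using low[OF ed(1), of l t] unfolding ref_def q_def by linarith
      then show ?thesis using \<gamma>(1) by (simp add: zero_less_mult_iff)
    qed
    then show ?thesis unfolding \<tau>_def using X(3) by (intro sum_pos) auto
  qed
  have cV: "c t i s \<in> V i" if "i < n" "s < dim (V i)" for t i s
  proof -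
    have "\<exists>g. orthonormal_basis g (V i) (c t i)"
      using comp[of t] that(1) unfolding compatible_bases_def by blast
    then show ?thesis using orthonormal_basis_in that(2) by blast
  qed
  have pq: "p t i f \<le> q t f" if "i < n" "linear f" for t i f
  proof -
    obtain g where "inner_on X g" "orthonormal_basis g X (B t)" "orthonormal_basis g (V i) (c t i)"
      using comp[of t] \<open>i < n\<close> unfolding compatible_bases_def by blast
    then show ?thesis
      unfolding p_def q_def using frame_form_subspace_le[of X g "B t" "V i" "c t i" f] V[OF that(1)] that(2)
      by simp
  qed
  have q\<tau>: "q t (ed l) \<le> \<tau> t" if "l < dim X" for t l
    unfolding \<tau>_def using that
    by (intro member_le_sum) (auto simp: q_def frame_form_nonneg)
  \<comment> \<open>The index \<open>n\<close> stands for the ambient space, so that all bases converge along one subsequence.\<close>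
  define d where "d i = (if i < n then dim (V i) else dim X)" for i
  define c' where "c' t i = (if i < n then c t i else B t)" for t i
  have c'X: "c' t i s \<in> X" if "i \<in> {..n}" "s < d i" for t i s
    using that cV[of i s t] V[of i] basis_of_in[OF B, of s t] unfolding c'_def d_def
    by (auto split: if_splits)
  have bd: "frame_form {..<d i} (c' t i) (ed l) \<le> \<tau> t" if "i \<in> {..n}" "l < dim X" for t i l
    using pq[OF _ ed(1), of i t l] q\<tau>[OF that(2), of t]
    unfolding c'_def d_def p_def q_def by (auto split: if_splits)
  obtain r w where r: "strict_mono (r :: nat \<Rightarrow> nat)" and wX: "\<forall>i s. w i s \<in> X"
    and lim: "\<forall>i\<in>{..n}. \<forall>s<d i. \<forall>f. linear f \<longrightarrow>
        (\<lambda>t. f (c' (r t) i s) / sqrt (\<tau> (r t))) \<longlonglongrightarrow> f (w i s)"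
    and limf: "\<forall>i\<in>{..n}. \<forall>f. linear f \<longrightarrow>
       (\<lambda>t. frame_form {..<d i} (c' (r t) i) f / \<tau> (r t)) \<longlonglongrightarrow> frame_form {..<d i} (w i) f"
    by (rule limit_of_forms[where X = X and I = "{..n}" and d = d and c = c' and \<tau> = \<tau>,
        OF e ed(1,3) finite_atMost c'X \<tau>0 bd, THEN exE], assumption+, elim exE conjE, rule that)
  have limq: "(\<lambda>t. q (r t) f / \<tau> (r t)) \<longlonglongrightarrow> frame_form {..<dim X} (w n) f" if "linear f" for f
    using limf[rule_format, of n f] that unfolding d_def c'_def q_def by simp
  have limp: "(\<lambda>t. p (r t) i f / \<tau> (r t)) \<longlonglongrightarrow> frame_form {..<dim (V i)} (w i) f" if "i < n" "linear f" for i f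
    using limf[rule_format, of i f] that unfolding d_def c'_def p_def by simp
  have wV: "w i s \<in> V i" if i: "i < n" and s: "s < dim (V i)" for i s
  proof (rule ccontr)
    assume "w i s \<notin> V i"
    then obtain f :: "'a \<Rightarrow> real" where f: "linear f" "\<And>x. x \<in> V i \<Longrightarrow> f x = 0" "f (w i s) = 1"
      using separating_functional V[OF i] by metis
    have "(\<lambda>t. f (c' (r t) i s) / sqrt (\<tau> (r t))) \<longlonglongrightarrow> f (w i s)"
      using lim[rule_format, of i s f] i s f(1) unfolding d_def by simp
    moreover have "f (c' t i s) = 0" for t using f(2)[OF cV[OF i s]] i unfolding c'_def by simp
    ultimately have "(\<lambda>t. 0) \<longlonglongrightarrow> (1::real)" using f(3) by simp
    then show False using LIMSEQ_unique[OF _ tendsto_const[of "0::real"]] by fastforce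
  qed
  have le: "frame_form {..<dim (V i)} (w i) f \<le> frame_form {..<dim X} (w n) f"
    if "i < n" "linear f" for i f
    using LIMSEQ_le[OF limp[OF that] limq[OF that(2)]] pq[OF that] \<tau>0
    by (meson divide_right_mono less_imp_le)
  \<comment> \<open>Monotonicity replaces the form at time \<open>Suc t\<close> in the recursion by
    the one at time \<open>t\<close>, so that both sides are taken along the same subsequence. The
    term \<open>ref f / \<tau> (r t)\<close> tends to 0.\<close>
  have ge: "\<gamma> * frame_form {..<dim X} (w n) f \<le> (\<Sum>i<n. frame_form {..<dim (V i)} (w i) f)"
    if f: "linear f" for f
  proof -
    have "filterlim (\<lambda>t. \<tau> (r t)) at_top sequentially"
      using filterlim_compose[OF \<tau>_top filterlim_subseq[OF r]] .
    then have "(\<lambda>t. ref f / \<tau> (r t)) \<longlonglongrightarrow> 0" by (rule real_tendsto_divide_at_top[OF tendsto_const])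
    then have "(\<lambda>t. (\<Sum>i<n. p (r t) i f / \<tau> (r t)) + ref f / \<tau> (r t))
        \<longlonglongrightarrow> (\<Sum>i<n. frame_form {..<dim (V i)} (w i) f) + 0"
      using limp[OF _ f] by (intro tendsto_add tendsto_sum) auto
    moreover have "(\<lambda>t. \<gamma> * (q (r t) f / \<tau> (r t))) \<longlonglongrightarrow> \<gamma> * frame_form {..<dim X} (w n) f"
      by (intro tendsto_mult tendsto_const limq[OF f])
    moreover have "\<gamma> * (q t f / \<tau> t) \<le> (\<Sum>i<n. p t i f / \<tau> t) + ref f / \<tau> t" for t
    proof -
      have "\<gamma> * q t f \<le> \<gamma> * q (Suc t) f" using mono[OF f, of t] \<gamma> unfolding q_def by simp
      also have "\<dots> = (\<Sum>i<n. p t i f) + ref f" using rec[OF f, of t] unfolding q_def p_def ref_def .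
      finally have "\<gamma> * q t f / \<tau> t \<le> ((\<Sum>i<n. p t i f) + ref f) / \<tau> t"
        using \<tau>0[of t] by (intro divide_right_mono) auto
      then show ?thesis by (simp add: add_divide_distrib sum_divide_distrib)
    qed
    ultimately show ?thesis by (auto intro: LIMSEQ_le)
  qed
  define R where "R = span (w n ` {..<dim X})"
  have "R \<subseteq> X" unfolding R_def using wX X(1)
    by (intro span_minimal) (auto simp: d_def)
  \<comment> \<open>The normalised forms have trace 1, and this survives in the limit.\<close>
  moreover have "\<exists>x\<in>R. x \<noteq> 0"
  proof (rule ccontr)
    assume "\<not> (\<exists>x\<in>R. x \<noteq> 0)"
    then have "w n j = 0" if "j < dim X" for j
      using that span_base[of "w n j" "w n ` {..<dim X}"] unfolding R_def by auto
    then have z: "frame_form {..<dim X} (w n) (ed l) = 0" for l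
      unfolding frame_form_def using linear_0[OF ed(1)[of l]] by simp
    have "(\<lambda>t. \<Sum>l<dim X. q (r t) (ed l) / \<tau> (r t)) \<longlonglongrightarrow> (\<Sum>l<dim X. frame_form {..<dim X} (w n) (ed l))"
      by (intro tendsto_sum limq ed(1))
    moreover have "(\<Sum>l<dim X. q t (ed l) / \<tau> t) = 1" for t
      using \<tau>0[of t] unfolding \<tau>_def by (simp flip: sum_divide_distrib)
    ultimately have "(\<lambda>t. 1) \<longlonglongrightarrow> (0::real)" using z by simp
    then show False using LIMSEQ_unique[OF _ tendsto_const[of "1::real"]] by fastforce
  qed
  moreover have "\<gamma> * dim R \<le> (\<Sum>i<n. real (dim (V i \<inter> R)))"
    unfolding R_def using V wV le ge
    by (intro subspace_of_forms_dense[where d = "\<lambda>i. dim (V i)" and v = w]) auto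
  ultimately show ?thesis using that[of R] unfolding R_def by simp
qed

section \<open>Induction over quotients\<close>

text \<open>The counting conditions concern only indices, and linear maps preserve inclusions in
  sums. Spaces that collapse to 0 stay in the list, so its length, and with it the lower bound
  \<open>\<delta> * n\<close>, is unchanged.\<close>

lemma alpha_delta_system_image:
  assumes sys: "alpha_delta_system \<alpha> \<delta> V S" and p: "linear p"
  shows "alpha_delta_system \<alpha> \<delta> (map ((`) p) V) S"
proof -
  have nth: "map ((`) p) V ! i = p ` (V ! i)" if "i \<in> T" "T \<in> set S" for i T
    using alpha_delta_systemD(1)[OF sys that(2)] that(1) by auto
  have img: "p ` A \<subseteq> p ` B + p ` C" if "A \<subseteq> B + C" for A B C
  proof
    fix y assume "y \<in> p ` A"
    then obtain b c where "y = p (b + c)" "b \<in> B" "c \<in> C"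
      using \<open>A \<subseteq> B + C\<close> by (metis image_iff set_plus_elim subsetD)
    then show "y \<in> p ` B + p ` C" using linear_add[OF p] by (auto intro: set_plus_intro)
  qed
  have triple: "map ((`) p) V ! i1 \<subseteq> map ((`) p) V ! i2 + map ((`) p) V ! i3 \<and>
      map ((`) p) V ! i2 \<subseteq> map ((`) p) V ! i1 + map ((`) p) V ! i3 \<and>
      map ((`) p) V ! i3 \<subseteq> map ((`) p) V ! i1 + map ((`) p) V ! i2"
    if "T \<in> set S" "card T = 3" "T = {i1, i2, i3}" for T i1 i2 i3
    using alpha_delta_systemD(3)[OF sys that] nth[OF _ that(1)] that(3) by (simp add: img)
  have pair: "map ((`) p) V ! i1 = map ((`) p) V ! i2"
    if "T \<in> set S" "card T = 2" "T = {i1, i2}" for T i1 i2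
    using alpha_delta_systemD(4)[OF sys that] nth[OF _ that(1)] that(3) by simp
  show ?thesis
    unfolding alpha_delta_system_def length_map
  proof (intro conjI)
    show "\<forall>T\<in>set S. T \<subseteq> {..<length V} \<and> (card T = 3 \<or> card T = 2)"
      using alpha_delta_systemD(1,2)[OF sys] by simp
    show "\<forall>i<length V. \<delta> * real (length V) \<le> real (length (filter (\<lambda>T. i \<in> T) S))"
      using alpha_delta_systemD(5)[OF sys] by simp
    show "\<forall>i1<length V. \<forall>i2<length V. i1 \<noteq> i2 \<longrightarrow> length (filter (\<lambda>T. {i1, i2} \<subseteq> T) S) \<le> \<alpha>"
      by (intro allI impI) (rule alpha_delta_systemD(6)[OF sys])
    show "\<forall>T\<in>set S. \<forall>i1 i2 i3. card T = 3 \<and> T = {i1, i2, i3} \<longrightarrow>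
        map ((`) p) V ! i1 \<subseteq> map ((`) p) V ! i2 + map ((`) p) V ! i3 \<and>
        map ((`) p) V ! i2 \<subseteq> map ((`) p) V ! i1 + map ((`) p) V ! i3 \<and>
        map ((`) p) V ! i3 \<subseteq> map ((`) p) V ! i1 + map ((`) p) V ! i2"
      by (intro ballI allI impI) (elim conjE, rule triple)
    show "\<forall>T\<in>set S. \<forall>i1 i2. card T = 2 \<and> T = {i1, i2} \<longrightarrow> map ((`) p) V ! i1 = map ((`) p) V ! i2"
      by (intro ballI allI impI) (elim conjE, rule pair)
  qed
qed

text \<open>An inner product violating the hypothesis \<open>no\<close> of
  \<open>dense_subspace_exists\<close> would satisfy the assumption of
  \<open>system_projection_bound\<close> with \<open>\<gamma>'\<close>, whose conclusion contradicts
  \<open>\<gamma>' < \<beta>\<close>.\<close>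

lemma system_dense_subspace:
  fixes V :: "'a::real_vector set list"
  assumes sys: "alpha_delta_system \<alpha> \<delta> V S" and \<alpha>: "\<alpha> > 0"
    and V: "\<And>i. i < length V \<Longrightarrow> subspace (V ! i) \<and> fin_dim (V ! i)"
    and X: "X = span (\<Union>i<length V. V ! i)" "dim X > 0"
    and \<gamma>: "0 < \<gamma>" "2 * real \<alpha> * \<gamma> < \<delta> * length V"
  obtains R where "subspace R" "R \<subseteq> X" "\<exists>x\<in>R. x \<noteq> 0"
    "\<gamma> * dim R \<le> (\<Sum>i<length V. real (dim (V ! i \<inter> R)))"
proof -
  \<comment> \<open>\<open>\<beta>\<close> is the threshold of
    \<open>system_projection_bound\<close>. A \<open>\<gamma>'\<close> strictly between leaves room
    on both sides: below \<open>\<beta>\<close> for the contradiction, above \<open>\<gamma>\<close>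
    for the growth of the trace.\<close>
  define \<beta> where "\<beta> = \<delta> * length V / (2 * real \<alpha>)"
  have "\<gamma> < \<beta>" using \<gamma>(2) \<alpha> by (simp add: \<beta>_def field_simps)
  then obtain \<gamma>' where \<gamma>': "\<gamma> < \<gamma>'" "\<gamma>' < \<beta>" using dense by blast
  have sX: "subspace X" using X(1) by simp
  have fX: "fin_dim X" unfolding X(1) using V by (intro fin_dim_span_UN) auto
  have VX: "subspace (V ! i) \<and> V ! i \<subseteq> X" if "i < length V" for i
    unfolding X(1) using V that by (auto intro!: span_base)
  have D: "(\<Sum>i<length V. dim (V ! i)) > 0"
  proof (rule ccontr)
    assume "\<not> 0 < (\<Sum>i<length V. dim (V ! i))"
    then have z: "dim (V ! i) = 0" if "i < length V" for i using that by simp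
    have "V ! i \<subseteq> {0}" if "i < length V" for i
      using dim_pos_fin_dim[of "V ! i"] V[OF that] z[OF that] by fastforce
    then have "X \<subseteq> span {}" unfolding X(1) by (intro span_minimal) auto
    then have "dim X \<le> card ({} :: 'a set)" by (intro dim_le_card) auto
    then show False using X(2) by simp
  qed
  have no: "\<exists>f. linear f \<and>
       \<gamma>' * frame_form {..<dim X} b f < (\<Sum>i<length V. frame_form {..<dim (V ! i)} (c i) f)"
    if comp: "compatible_bases X (length V) ((!) V) b c" for b c
  proof (rule ccontr)
    assume neg: "\<not> ?thesis"
    obtain g where g: "inner_on X g" "orthonormal_basis g X b"
      "\<And>i. i < length V \<Longrightarrow> orthonormal_basis g (V ! i) (c i)"
      using comp unfolding compatible_bases_def by metis
    have sym: "g x y = g y x" for x y using g(1) unfolding inner_on_def by blast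
    have "(\<Sum>i<length V. \<Sum>s<dim (V ! i). (g x (c i s))\<^sup>2) \<le> \<gamma>' * g x x" if "x \<in> X" for x
    proof -
      have "(\<Sum>i<length V. \<Sum>s<dim (V ! i). (g x (c i s))\<^sup>2) \<le> \<gamma>' * frame_form {..<dim X} b (g x)"
        using neg inner_on_linear(1)[OF g(1), of x] unfolding frame_form_def by (meson not_le)
      also have "frame_form {..<dim X} b (g x) = (\<Sum>j<dim X. g (b j) x * g (b j) x)"
        unfolding frame_form_def by (simp add: power2_eq_square sym[of x "b _"])
      also have "\<dots> = g x x" using orthonormal_basis_parseval[OF g(1,2) that] by simp
      finally show ?thesis .
    qed
    then have "\<delta> * length V \<le> 2 * real \<alpha> * \<gamma>'"
      using VX V by (intro system_projection_bound[OF sys g(1) sX _ g(3) _ D]) auto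
    then show False using \<gamma>'(2) \<alpha> by (simp add: \<beta>_def field_simps)
  qed
  show ?thesis
    by (rule dense_subspace_exists[where V = "(!) V", OF sX fX X(2) VX \<gamma>(1) \<gamma>'(1) no]) (auto intro: that)
qed

text \<open>Strong induction on the dimension of the span. The bound is additive along
  \<open>R\<close> and the quotient by \<open>R\<close>: dimensions of the \<open>V ! i\<close>
  split into those of \<open>V ! i \<inter> R\<close>, controlled by density, and of the images,
  controlled by induction.\<close>

lemma system_dim_bound:
  fixes V :: "'a::real_vector set list"
  assumes "alpha_delta_system \<alpha> \<delta> V S" "\<alpha> > 0"
    "\<And>i. i < length V \<Longrightarrow> subspace (V ! i) \<and> fin_dim (V ! i)"
  shows "\<delta> * length V * dim (\<Union>i<length V. V ! i) \<le> 2 * real \<alpha> * (\<Sum>i<length V. real (dim (V ! i)))"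
  using assms
proof (induction "dim (\<Union>i<length V. V ! i)" arbitrary: V rule: less_induct)
  case less
  note sys = less.prems(1) and \<alpha> = less.prems(2) and V = less.prems(3)
  define n where "n = length V"
  define X where "X = span (\<Union>i<n. V ! i)"
  define D where "D = (\<Sum>i<n. real (dim (V ! i)))"
  have D0: "D \<ge> 0" unfolding D_def by (simp add: sum_nonneg)
  have dX: "dim (\<Union>i<n. V ! i) = dim X" unfolding X_def by simp
  have fX: "fin_dim X" unfolding X_def n_def using V by (intro fin_dim_span_UN) auto
  have *: "\<gamma> * dim X \<le> D" if dim: "dim X > 0" and \<gamma>: "0 < \<gamma>" "2 * real \<alpha> * \<gamma> < \<delta> * n" for \<gamma>
  proof -
    obtain R where R: "subspace R" "R \<subseteq> X" "\<exists>x\<in>R. x \<noteq> 0"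
      "\<gamma> * dim R \<le> (\<Sum>i<n. real (dim (V ! i \<inter> R)))"
      using system_dense_subspace[OF sys \<alpha> V X_def[unfolded n_def] dim \<gamma>(1) \<gamma>(2)[unfolded n_def]]
      unfolding n_def by metis
    have fR: "fin_dim R" by (rule fin_dim_subset[OF R(2) fX])
    have dR: "dim R > 0" using dim_pos_fin_dim[OF fR] R(3) by blast
    obtain p :: "'a \<Rightarrow> 'a" where p: "linear p" "\<And>x. p x = 0 \<longleftrightarrow> x \<in> R"
      using linear_with_kernel[OF R(1)] by metis
    define W where "W = map ((`) p) V"
    have lW: "length W = n" unfolding W_def n_def by simp
    have nth: "W ! i = p ` (V ! i)" if "i < n" for i using that unfolding W_def n_def by simp
    have sysW: "alpha_delta_system \<alpha> \<delta> W S" unfolding W_def by (rule alpha_delta_system_image[OF sys p(1)])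
    have W: "subspace (W ! i) \<and> fin_dim (W ! i)" if "i < length W" for i
      using that V[of i] nth[of i] lW linear_subspace_image[OF p(1)] fin_dim_image[OF p(1)]
      unfolding n_def by simp
    have UW: "(\<Union>i<n. W ! i) = p ` (\<Union>i<n. V ! i)" using nth by auto
    have dW: "dim (\<Union>i<n. W ! i) = dim (p ` X)"
      unfolding UW X_def using linear_span_image[OF p(1)] by (metis dim_span)
    have "dim (p ` X) + dim (X \<inter> R) \<le> dim X"
      using p by (intro dim_image_add_dim_kernel_le fX) auto
    then have lt: "dim (p ` X) < dim X" using dR R(2) by (simp add: Int_absorb1)
    have "\<delta> * n * dim (p ` X) \<le> 2 * real \<alpha> * (\<Sum>i<n. real (dim (W ! i)))"
      using less.hyps[OF _ sysW \<alpha> W] lt unfolding lW n_def[symmetric] dX dW by simp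
    \<comment> \<open>The induction hypothesis is weakened from \<open>\<delta> * n\<close> to
      \<open>2 * \<alpha> * \<gamma>\<close> so that it adds up with the density of
      \<open>R\<close>.\<close>
    moreover have "2 * real \<alpha> * \<gamma> * dim (p ` X) \<le> \<delta> * n * dim (p ` X)"
      using \<gamma>(2) by (intro mult_right_mono) auto
    ultimately have "2 * real \<alpha> * (\<gamma> * dim (p ` X)) \<le> 2 * real \<alpha> * (\<Sum>i<n. real (dim (W ! i)))" by simp
    then have IH: "\<gamma> * dim (p ` X) \<le> (\<Sum>i<n. real (dim (W ! i)))" using \<alpha> by simp
    have "dim X \<le> dim (p ` X) + dim R"
      using p by (intro dim_le_dim_image_add_dim_kernel fX fR) auto
    then have "real (dim X) \<le> real (dim (p ` X)) + real (dim R)" by linarith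
    then have "\<gamma> * dim X \<le> \<gamma> * (real (dim (p ` X)) + real (dim R))"
      using \<gamma>(1) by (intro mult_left_mono) auto
    also have "\<dots> \<le> (\<Sum>i<n. real (dim (W ! i))) + (\<Sum>i<n. real (dim (V ! i \<inter> R)))"
      using IH R(4) by (simp add: distrib_left)
    also have "\<dots> = (\<Sum>i<n. real (dim (p ` (V ! i)) + dim (V ! i \<inter> R)))"
      using nth by (simp add: sum.distrib)
    also have "\<dots> \<le> D"
      unfolding D_def using p V unfolding n_def
      by (intro sum_mono of_nat_mono dim_image_add_dim_kernel_le) auto
    finally show ?thesis .
  qed
  have "\<delta> * n * dim X \<le> 2 * real \<alpha> * D"
  proof (rule ccontr)
    assume neg: "\<not> ?thesis"
    then have dim: "dim X > 0" using D0 by (cases "dim X") auto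
    \<comment> \<open>A dense subspace is available only strictly below the threshold; the strict
      failure of the bound leaves a gap in which \<open>\<gamma>\<close> can be chosen.\<close>
    have "D / dim X < \<delta> * n / (2 * real \<alpha>)" using neg dim \<alpha> by (simp add: field_simps)
    then obtain \<gamma> where \<gamma>: "D / dim X < \<gamma>" "\<gamma> < \<delta> * n / (2 * real \<alpha>)" using dense by blast
    have "0 \<le> D / dim X" using D0 by simp
    then have "0 < \<gamma>" using \<gamma>(1) by linarith
    moreover have "2 * real \<alpha> * \<gamma> < \<delta> * n" using \<gamma>(2) \<alpha> by (simp add: field_simps)
    ultimately have "\<gamma> * dim X \<le> D" using *[OF dim] by blast
    then show False using \<gamma>(1) dim by (simp add: field_simps)
  qed
  then show ?case unfolding dX[symmetric] D_def n_def .
qed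

section \<open>The coordinate space and the absolute constant\<close>

lemma fin_dim_real_space: "fin_dim (real_space l)"
proof -
  let ?B = "(\<lambda>i. Poly_Mapping.single i (1::real)) ` {..<l}"
  have "x \<in> span ?B" if "x \<in> real_space l" for x
  proof -
    have keys: "Poly_Mapping.keys x \<subseteq> {..<l}" using that by (simp add: real_space_def)
    \<comment> \<open>Scaling of polynomial mappings is defined through the abstraction function, so
      finiteness of the support has to be checked before coordinates can be read off.\<close>
    have look: "Poly_Mapping.lookup (r *\<^sub>R y) i = r * Poly_Mapping.lookup y i" for r i and y :: "nat \<Rightarrow>\<^sub>0 real"
    proof -
      have "finite {i. r * Poly_Mapping.lookup y i \<noteq> 0}"
        by (rule finite_subset[OF _ finite_keys[of y]]) (auto simp: in_keys_iff)
      then show ?thesis by (simp add: scaleR_poly_mapping_def Abs_poly_mapping_inverse)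
    qed
    have "x = (\<Sum>i<l. Poly_Mapping.lookup x i *\<^sub>R Poly_Mapping.single i 1)"
    proof (rule poly_mapping_eqI)
      fix j
      have "(\<Sum>i<l. Poly_Mapping.lookup x i * Poly_Mapping.lookup (Poly_Mapping.single i (1::real)) j)
          = (\<Sum>i<l. if i = j then Poly_Mapping.lookup x j else 0)"
        by (intro sum.cong refl) (auto simp: lookup_single when_def)
      also have "\<dots> = Poly_Mapping.lookup x j"
        using keys by (auto simp: in_keys_iff subset_iff)
      finally show "Poly_Mapping.lookup x j
          = Poly_Mapping.lookup (\<Sum>i<l. Poly_Mapping.lookup x i *\<^sub>R Poly_Mapping.single i 1) j"
        by (simp add: lookup_sum look)
    qed
    also have "\<dots> \<in> span ?B" by (intro span_sum span_scale span_base) auto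
    finally show ?thesis .
  qed
  then show ?thesis unfolding fin_dim_def by (intro exI[of _ ?B]) auto
qed

lemma sum_list_subset_span:
  fixes V :: "'a::real_vector set list"
  shows "sum_list V \<subseteq> span (\<Union>(set V))"
proof (induction V)
  case Nil
  then show ?case by (simp add: span_zero set_zero)
next
  case (Cons U V)
  have "U \<subseteq> span (\<Union>(set (U # V)))" by (auto intro: span_base)
  moreover have "sum_list V \<subseteq> span (\<Union>(set (U # V)))"
    using Cons.IH span_mono[of "\<Union>(set V)" "\<Union>(set (U # V))"] by auto
  ultimately have "U + sum_list V \<subseteq> span (\<Union>(set (U # V)))"
    by (auto elim!: set_plus_elim intro: span_add)
  then show ?case by simp
qed

theorem theorem12:
  shows "\<exists>C::real. C > 0 \<and>
    (\<forall>(l::nat) (V :: (nat \<Rightarrow>\<^sub>0 real) set list) (k::nat) (\<alpha>::nat) (\<delta>::real).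
       (\<forall>U \<in> set V. subspace U \<and> U \<subseteq> real_space l \<and> dim U \<le> k) \<longrightarrow>
       \<alpha> > 0 \<longrightarrow> \<delta> > 0 \<longrightarrow>
       (\<exists>S. alpha_delta_system \<alpha> \<delta> V S) \<longrightarrow>
       real (dim (sum_list V)) \<le> C * real \<alpha> ^ 2 * real k ^ 4 / \<delta> ^ 2)"
proof (intro exI[of _ 4] conjI allI impI)
  fix l :: nat and V :: "(nat \<Rightarrow>\<^sub>0 real) set list" and k \<alpha> :: nat and \<delta> :: real
  assume V: "\<forall>U\<in>set V. subspace U \<and> U \<subseteq> real_space l \<and> dim U \<le> k"
    and \<alpha>: "\<alpha> > 0" and \<delta>: "\<delta> > 0" and "\<exists>S. alpha_delta_system \<alpha> \<delta> V S"
  then obtain S where S: "alpha_delta_system \<alpha> \<delta> V S" by blast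
  define n where "n = length V"
  define d where "d = dim (\<Union>i<n. V ! i)"
  have Vi: "subspace (V ! i) \<and> fin_dim (V ! i) \<and> dim (V ! i) \<le> k" if "i < n" for i
    using V fin_dim_subset[OF _ fin_dim_real_space] that unfolding n_def by (metis nth_mem)
  have "set V = (!) V ` {..<n}" unfolding n_def by (auto simp: set_conv_nth)
  then have UV: "(\<Union>i<n. V ! i) = \<Union>(set V)" by simp
  have "fin_dim (span (\<Union>i<n. V ! i))" by (intro fin_dim_span_UN) (simp_all add: Vi)
  then have "dim (sum_list V) \<le> dim (span (\<Union>i<n. V ! i))"
    using sum_list_subset_span[of V] by (intro dim_mono_fin_dim) (simp_all add: UV)
  then have le: "dim (sum_list V) \<le> d" by (simp add: d_def)
  show "real (dim (sum_list V)) \<le> 4 * real \<alpha> ^ 2 * real k ^ 4 / \<delta> ^ 2"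
  proof (cases "d = 0")
    case True then show ?thesis using le by simp
  next
    case False
    then have d1: "real d \<ge> 1" by simp
    have n0: "n > 0"
    proof (rule ccontr)
      assume "\<not> n > 0"
      then have "(\<Union>i<n. V ! i) = {}" by simp
      then show False using False dim_le_card[of "{} :: (nat \<Rightarrow>\<^sub>0 real) set" "{}"] unfolding d_def by simp
    qed
    have "\<delta> * n * d \<le> 2 * real \<alpha> * (\<Sum>i<n. real (dim (V ! i)))"
      using system_dim_bound[OF S \<alpha>] Vi unfolding d_def n_def by simp
    also have "\<dots> \<le> 2 * real \<alpha> * (\<Sum>i<n. real k)"
      using Vi by (intro mult_left_mono sum_mono) auto
    finally have "n * (\<delta> * d) \<le> n * (2 * real \<alpha> * k)" by (simp add: mult_ac)
    then have "\<delta> * d \<le> 2 * real \<alpha> * k" using n0 by simp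
    \<comment> \<open>The bound \<open>d \<le> x\<close> is linear in
      \<open>\<alpha> * k / \<delta>\<close>. Since \<open>1 \<le> d \<le> x\<close>, it may be
      squared, which is where the constant 4 arises; the case \<open>d = 0\<close> was split off for
      this reason.\<close>
    define x where "x = 2 * real \<alpha> * k / \<delta>"
    have dx: "real d \<le> x" using \<open>\<delta> * d \<le> 2 * real \<alpha> * k\<close> \<delta> by (simp add: x_def field_simps)
    have "x * 1 \<le> x * x" using d1 dx by (intro mult_left_mono) auto
    then have "real d \<le> x\<^sup>2" using dx by (simp add: power2_eq_square)
    also have "\<dots> = 4 * real \<alpha> ^ 2 * real k ^ 2 / \<delta> ^ 2"
      by (simp add: x_def power_divide power_mult_distrib)
    also have "\<dots> \<le> 4 * real \<alpha> ^ 2 * real k ^ 4 / \<delta> ^ 2"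
    proof -
      have "k ^ 2 \<le> k ^ 4" by (cases "k = 0") (auto intro: power_increasing)
      then have "real k ^ 2 \<le> real k ^ 4" by (metis of_nat_le_iff of_nat_power)
      then show ?thesis by (intro divide_right_mono mult_left_mono) auto
    qed
    finally show ?thesis using le by linarith
  qed
qed simp

end
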